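(* Let $\mathcal{A}$ be a regular category and let $n\ge 3$ be an integer. Then $\mathcal{A}$ is an exact arithmetical category if and only if, for every $n$-tuple of regular epimorphisms $r_i\colon X\to B_i$ ($1\le i\le n$) with common domain, the pairwise pushouts $B_i\to D_{ij}\leftarrow B_j$ of $(r_i,r_j)$ exist for all $1\le i<j\le n$ and the canonical comparison morphism, induced by the cone $(r_i)_i$, from $X$ to the limit of the diagram formed by the objects $B_i$, $D_{ij}$ and the pushout coprojections $B_i\to D_{ij}\leftarrow B_j$ ($i<j$) is a regular epimorphism.
   Context: All categories are assumed finitely complete. A category is regular if kernel pairs admit coequalizers and regular epimorphisms are stable under pullback. It is (Barr-)exact if it is regular and every internal equivalence relation is effective, i.e. is the kernel pair of some morphism. A Mal'tsev category is a finitely complete category in which every internal reflexive relation $R\rightarrowtail X\times X$ is an equivalence relation. For an object $X$, $\mathrm{Equiv}(X)$ denotes the poset of internal equivalence relations on $X$, ordered by inclusion of subobjects of $X\times X$; in an exact Mal'tsev category it is a lattice (meets are intersections, and the join of $\theta$ and $\varphi$ is the relational composite $\theta\circ\varphi=\varphi\circ\theta$). An (exact) arithmetical category is an exact Mal'tsev category such that the lattice $\mathrm{Equiv}(X)$ is distributive for every object $X$. *)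

theory Defs
  imports Complex_Main "HOL-Algebra.Lattice"
begin

section \<open>Categories\<close>

record ('o, 'm) category_data =
  Obj  :: "'o set"
  Arr  :: "'m set"
  Dom  :: "'m \<Rightarrow> 'o"
  Cod  :: "'m \<Rightarrow> 'o"
  Id   :: "'o \<Rightarrow> 'm"
  Comp :: "'m \<Rightarrow> 'm \<Rightarrow> 'm"  (infixr \<open>\<odot>\<index>\<close> 70)

definition Hom :: "('o, 'm, 'z) category_data_scheme \<Rightarrow> 'o \<Rightarrow> 'o \<Rightarrow> 'm set" where
  "Hom C A B = {f \<in> Arr C. Dom C f = A \<and> Cod C f = B}"

locale category =
  fixes C :: "('o, 'm) category_data" (structure)
  assumes Dom_Obj: "f \<in> Arr C \<Longrightarrow> Dom C f \<in> Obj C"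
    and Cod_Obj: "f \<in> Arr C \<Longrightarrow> Cod C f \<in> Obj C"
    and Id_Hom: "A \<in> Obj C \<Longrightarrow> Id C A \<in> Hom C A A"
    and Comp_Hom: "\<lbrakk>f \<in> Hom C X Y; g \<in> Hom C Y Z\<rbrakk> \<Longrightarrow> g \<odot> f \<in> Hom C X Z"
    and Comp_Id: "f \<in> Hom C X Y \<Longrightarrow> f \<odot> Id C X = f"
    and Id_Comp: "f \<in> Hom C X Y \<Longrightarrow> Id C Y \<odot> f = f"
    and Comp_assoc: "\<lbrakk>f \<in> Hom C W X; g \<in> Hom C X Y; h \<in> Hom C Y Z\<rbrakk>
                      \<Longrightarrow> (h \<odot> g) \<odot> f = h \<odot> (g \<odot> f)"


section \<open>Limits of diagrams\<close>

text \<open>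
  The shape of a diagram is a directed multigraph.  A functor on a category is in particular a
  diagram on the underlying graph of that category, with the same cones and the same limits.
\<close>

record ('v, 'e, 'o, 'm) diagram =
  Nodes :: "'v set"
  Edges :: "'e set"
  Src   :: "'e \<Rightarrow> 'v"
  Tgt   :: "'e \<Rightarrow> 'v"
  ObjAt :: "'v \<Rightarrow> 'o"
  ArrAt :: "'e \<Rightarrow> 'm"

definition is_diagram :: "('o, 'm) category_data \<Rightarrow> ('v, 'e, 'o, 'm) diagram \<Rightarrow> bool" where
  "is_diagram C G \<longleftrightarrow>
     (\<forall>v\<in>Nodes G. ObjAt G v \<in> Obj C) \<and>
     (\<forall>e\<in>Edges G. Src G e \<in> Nodes G \<and> Tgt G e \<in> Nodes G \<and>
        ArrAt G e \<in> Hom C (ObjAt G (Src G e)) (ObjAt G (Tgt G e)))"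

definition is_cone ::
  "('o, 'm) category_data \<Rightarrow> ('v, 'e, 'o, 'm) diagram \<Rightarrow> 'o \<Rightarrow> ('v \<Rightarrow> 'm) \<Rightarrow> bool" where
  "is_cone C G X c \<longleftrightarrow>
     X \<in> Obj C \<and>
     (\<forall>v\<in>Nodes G. c v \<in> Hom C X (ObjAt G v)) \<and>
     (\<forall>e\<in>Edges G. ArrAt G e \<odot>\<^bsub>C\<^esub> c (Src G e) = c (Tgt G e))"

definition mediates ::
  "('o, 'm) category_data \<Rightarrow> ('v, 'e, 'o, 'm) diagram \<Rightarrow> 'o \<Rightarrow> ('v \<Rightarrow> 'm) \<Rightarrow> 'o \<Rightarrow> ('v \<Rightarrow> 'm)
     \<Rightarrow> 'm \<Rightarrow> bool" where
  "mediates C G L l X c h \<longleftrightarrow> h \<in> Hom C X L \<and> (\<forall>v\<in>Nodes G. l v \<odot>\<^bsub>C\<^esub> h = c v)"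

definition is_limit ::
  "('o, 'm) category_data \<Rightarrow> ('v, 'e, 'o, 'm) diagram \<Rightarrow> 'o \<Rightarrow> ('v \<Rightarrow> 'm) \<Rightarrow> bool" where
  "is_limit C G L l \<longleftrightarrow>
     is_cone C G L l \<and> (\<forall>X c. is_cone C G X c \<longrightarrow> (\<exists>!h. mediates C G L l X c h))"

definition comparison ::
  "('o, 'm) category_data \<Rightarrow> ('v, 'e, 'o, 'm) diagram \<Rightarrow> 'o \<Rightarrow> ('v \<Rightarrow> 'm) \<Rightarrow> 'o \<Rightarrow> ('v \<Rightarrow> 'm)
     \<Rightarrow> 'm" where
  "comparison C G L l X c = (THE h. mediates C G L l X c h)"

text \<open>Every finite graph is isomorphic to one whose nodes and edges are natural numbers.\<close>

locale finitely_complete_category = category +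
  assumes finite_limits:
    "\<And>G :: (nat, nat, 'a, 'b) diagram.
       \<lbrakk>finite (Nodes G); finite (Edges G); is_diagram C G\<rbrakk> \<Longrightarrow> \<exists>L l. is_limit C G L l"


section \<open>Particular limits and colimits\<close>

definition is_product :: "('o, 'm) category_data \<Rightarrow> 'o \<Rightarrow> 'o \<Rightarrow> 'o \<Rightarrow> 'm \<Rightarrow> 'm \<Rightarrow> bool" where
  "is_product C A B P p q \<longleftrightarrow>
     p \<in> Hom C P A \<and> q \<in> Hom C P B \<and>
     (\<forall>X f g. f \<in> Hom C X A \<and> g \<in> Hom C X B \<longrightarrow>
        (\<exists>!h. h \<in> Hom C X P \<and> p \<odot>\<^bsub>C\<^esub> h = f \<and> q \<odot>\<^bsub>C\<^esub> h = g))"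

text \<open>\<open>p\<close> and \<open>q\<close> are the projections to the domains of \<open>f\<close> and \<open>g\<close> respectively.\<close>

definition is_pullback :: "('o, 'm) category_data \<Rightarrow> 'm \<Rightarrow> 'm \<Rightarrow> 'm \<Rightarrow> 'm \<Rightarrow> bool" where
  "is_pullback C f g p q \<longleftrightarrow>
     f \<in> Arr C \<and> g \<in> Arr C \<and> Cod C f = Cod C g \<and>
     p \<in> Hom C (Dom C p) (Dom C f) \<and> q \<in> Hom C (Dom C p) (Dom C g) \<and>
     f \<odot>\<^bsub>C\<^esub> p = g \<odot>\<^bsub>C\<^esub> q \<and>
     (\<forall>X a b. a \<in> Hom C X (Dom C f) \<and> b \<in> Hom C X (Dom C g) \<and> f \<odot>\<^bsub>C\<^esub> a = g \<odot>\<^bsub>C\<^esub> b \<longrightarrow>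
        (\<exists>!h. h \<in> Hom C X (Dom C p) \<and> p \<odot>\<^bsub>C\<^esub> h = a \<and> q \<odot>\<^bsub>C\<^esub> h = b))"

definition is_pushout :: "('o, 'm) category_data \<Rightarrow> 'm \<Rightarrow> 'm \<Rightarrow> 'm \<Rightarrow> 'm \<Rightarrow> bool" where
  "is_pushout C f g p q \<longleftrightarrow>
     f \<in> Arr C \<and> g \<in> Arr C \<and> Dom C f = Dom C g \<and>
     p \<in> Hom C (Cod C f) (Cod C p) \<and> q \<in> Hom C (Cod C g) (Cod C p) \<and>
     p \<odot>\<^bsub>C\<^esub> f = q \<odot>\<^bsub>C\<^esub> g \<and>
     (\<forall>Y a b. a \<in> Hom C (Cod C f) Y \<and> b \<in> Hom C (Cod C g) Y \<and> a \<odot>\<^bsub>C\<^esub> f = b \<odot>\<^bsub>C\<^esub> g \<longrightarrow>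
        (\<exists>!h. h \<in> Hom C (Cod C p) Y \<and> h \<odot>\<^bsub>C\<^esub> p = a \<and> h \<odot>\<^bsub>C\<^esub> q = b))"

definition is_kernel_pair :: "('o, 'm) category_data \<Rightarrow> 'm \<Rightarrow> 'm \<Rightarrow> 'm \<Rightarrow> bool" where
  "is_kernel_pair C f p q \<longleftrightarrow> is_pullback C f f p q"

definition is_coequalizer :: "('o, 'm) category_data \<Rightarrow> 'm \<Rightarrow> 'm \<Rightarrow> 'm \<Rightarrow> bool" where
  "is_coequalizer C u v e \<longleftrightarrow>
     u \<in> Arr C \<and> v \<in> Hom C (Dom C u) (Cod C u) \<and> e \<in> Hom C (Cod C u) (Cod C e) \<and>
     e \<odot>\<^bsub>C\<^esub> u = e \<odot>\<^bsub>C\<^esub> v \<and>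
     (\<forall>Y a. a \<in> Hom C (Cod C u) Y \<and> a \<odot>\<^bsub>C\<^esub> u = a \<odot>\<^bsub>C\<^esub> v \<longrightarrow>
        (\<exists>!h. h \<in> Hom C (Cod C e) Y \<and> h \<odot>\<^bsub>C\<^esub> e = a))"

definition regular_epi :: "('o, 'm) category_data \<Rightarrow> 'm \<Rightarrow> bool" where
  "regular_epi C e \<longleftrightarrow> (\<exists>u v. is_coequalizer C u v e)"

definition monic :: "('o, 'm) category_data \<Rightarrow> 'm \<Rightarrow> bool" where
  "monic C m \<longleftrightarrow> m \<in> Arr C \<and>
     (\<forall>X a b. a \<in> Hom C X (Dom C m) \<and> b \<in> Hom C X (Dom C m) \<and> m \<odot>\<^bsub>C\<^esub> a = m \<odot>\<^bsub>C\<^esub> b \<longrightarrow> a = b)"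


section \<open>Internal relations\<close>

text \<open>
  An internal relation on \<open>X\<close> is a monomorphism \<open>m\<close> into a product \<open>(P, p, q)\<close> of \<open>X\<close> with itself;
  its two legs are \<open>p \<odot> m\<close> and \<open>q \<odot> m\<close>.  No products are chosen: \<open>(P, p, q)\<close> is a parameter,
  and it is quantified over wherever relations are.
\<close>

definition is_relation :: "('o, 'm) category_data \<Rightarrow> 'o \<Rightarrow> 'o \<Rightarrow> 'm \<Rightarrow> 'm \<Rightarrow> 'm \<Rightarrow> bool" where
  "is_relation C X P p q m \<longleftrightarrow> is_product C X X P p q \<and> monic C m \<and> Cod C m = P"

definition is_reflexive :: "('o, 'm) category_data \<Rightarrow> 'o \<Rightarrow> 'm \<Rightarrow> 'm \<Rightarrow> 'm \<Rightarrow> bool" where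
  "is_reflexive C X p q m \<longleftrightarrow>
     (\<exists>s\<in>Hom C X (Dom C m). (p \<odot>\<^bsub>C\<^esub> m) \<odot>\<^bsub>C\<^esub> s = Id C X \<and> (q \<odot>\<^bsub>C\<^esub> m) \<odot>\<^bsub>C\<^esub> s = Id C X)"

definition is_symmetric :: "('o, 'm) category_data \<Rightarrow> 'm \<Rightarrow> 'm \<Rightarrow> 'm \<Rightarrow> bool" where
  "is_symmetric C p q m \<longleftrightarrow>
     (\<exists>s\<in>Hom C (Dom C m) (Dom C m).
        (p \<odot>\<^bsub>C\<^esub> m) \<odot>\<^bsub>C\<^esub> s = q \<odot>\<^bsub>C\<^esub> m \<and> (q \<odot>\<^bsub>C\<^esub> m) \<odot>\<^bsub>C\<^esub> s = p \<odot>\<^bsub>C\<^esub> m)"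

text \<open>
  The pullback of the second leg along the first is the object of composable pairs
  \<open>x R y R z\<close>, with projections \<open>a\<close> to \<open>(x, y)\<close> and \<open>b\<close> to \<open>(y, z)\<close>.
\<close>

definition is_transitive :: "('o, 'm) category_data \<Rightarrow> 'm \<Rightarrow> 'm \<Rightarrow> 'm \<Rightarrow> bool" where
  "is_transitive C p q m \<longleftrightarrow>
     (\<forall>a b. is_pullback C (q \<odot>\<^bsub>C\<^esub> m) (p \<odot>\<^bsub>C\<^esub> m) a b \<longrightarrow>
        (\<exists>t\<in>Hom C (Dom C a) (Dom C m).
           (p \<odot>\<^bsub>C\<^esub> m) \<odot>\<^bsub>C\<^esub> t = (p \<odot>\<^bsub>C\<^esub> m) \<odot>\<^bsub>C\<^esub> a \<and> (q \<odot>\<^bsub>C\<^esub> m) \<odot>\<^bsub>C\<^esub> t = (q \<odot>\<^bsub>C\<^esub> m) \<odot>\<^bsub>C\<^esub> b))"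

definition is_equivalence_relation ::
  "('o, 'm) category_data \<Rightarrow> 'o \<Rightarrow> 'o \<Rightarrow> 'm \<Rightarrow> 'm \<Rightarrow> 'm \<Rightarrow> bool" where
  "is_equivalence_relation C X P p q m \<longleftrightarrow>
     is_relation C X P p q m \<and> is_reflexive C X p q m \<and> is_symmetric C p q m \<and> is_transitive C p q m"

definition is_effective :: "('o, 'm) category_data \<Rightarrow> 'm \<Rightarrow> 'm \<Rightarrow> 'm \<Rightarrow> bool" where
  "is_effective C p q m \<longleftrightarrow> (\<exists>f. is_kernel_pair C f (p \<odot>\<^bsub>C\<^esub> m) (q \<odot>\<^bsub>C\<^esub> m))"

definition subobject_le :: "('o, 'm) category_data \<Rightarrow> 'm \<Rightarrow> 'm \<Rightarrow> bool" where
  "subobject_le C m m' \<longleftrightarrow> (\<exists>h\<in>Hom C (Dom C m) (Dom C m'). m' \<odot>\<^bsub>C\<^esub> h = m)"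

text \<open>
  The poset of internal equivalence relations on \<open>X\<close>.  Subobjects are represented by
  monomorphisms, so equality of elements of this poset is the equivalence \<open>eq\<close> of
  monomorphisms that factor through each other.
\<close>

definition Equiv :: "('o, 'm) category_data \<Rightarrow> 'o \<Rightarrow> 'o \<Rightarrow> 'm \<Rightarrow> 'm \<Rightarrow> 'm gorder" where
  "Equiv C X P p q =
     \<lparr>carrier = {m. is_equivalence_relation C X P p q m},
      eq = (\<lambda>m m'. subobject_le C m m' \<and> subobject_le C m' m),
      le = subobject_le C\<rparr>"

locale weak_distributive_lattice = weak_lattice +
  assumes meet_join_distrib:
    "\<lbrakk>x \<in> carrier L; y \<in> carrier L; z \<in> carrier L\<rbrakk> \<Longrightarrow> x \<sqinter> (y \<squnion> z) .= (x \<sqinter> y) \<squnion> (x \<sqinter> z)"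


section \<open>Regular, exact, Mal'tsev and arithmetical categories\<close>

locale regular_category = finitely_complete_category +
  assumes kernel_pair_coequalizer:
      "is_kernel_pair C f p q \<Longrightarrow> \<exists>e. is_coequalizer C p q e"
    and regular_epi_pullback_stable:
      "\<lbrakk>is_pullback C f g p q; regular_epi C f\<rbrakk> \<Longrightarrow> regular_epi C q"

locale exact_category = regular_category +
  assumes equivalence_relation_effective:
    "is_equivalence_relation C X P p q m \<Longrightarrow> is_effective C p q m"

locale maltsev_category = finitely_complete_category +
  assumes reflexive_relation_equivalence:
    "\<lbrakk>is_relation C X P p q m; is_reflexive C X p q m\<rbrakk> \<Longrightarrow> is_equivalence_relation C X P p q m"

locale exact_arithmetical_category = exact_category + maltsev_category +
  assumes Equiv_distributive:
    "is_product C X X P p q \<Longrightarrow> weak_distributive_lattice (Equiv C X P p q)"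


section \<open>The diagram of pairwise pushouts\<close>

datatype pairwise_node = Base nat | Apex nat nat
datatype pairwise_edge = LeftLeg nat nat | RightLeg nat nat

text \<open>
  Nodes \<open>B i\<close> and \<open>D i j\<close>, and edges \<open>p i j : B i \<rightarrow> D i j\<close> and \<open>q i j : B j \<rightarrow> D i j\<close>,
  for \<open>1 \<le> i < j \<le> n\<close>.
\<close>

definition pairwise_diagram ::
  "nat \<Rightarrow> (nat \<Rightarrow> 'o) \<Rightarrow> (nat \<Rightarrow> nat \<Rightarrow> 'o) \<Rightarrow> (nat \<Rightarrow> nat \<Rightarrow> 'm) \<Rightarrow> (nat \<Rightarrow> nat \<Rightarrow> 'm)
     \<Rightarrow> (pairwise_node, pairwise_edge, 'o, 'm) diagram" where
  "pairwise_diagram n B D p q =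
     \<lparr>Nodes = {Base i | i. 1 \<le> i \<and> i \<le> n} \<union> {Apex i j | i j. 1 \<le> i \<and> i < j \<and> j \<le> n},
      Edges = {LeftLeg i j | i j. 1 \<le> i \<and> i < j \<and> j \<le> n}
                \<union> {RightLeg i j | i j. 1 \<le> i \<and> i < j \<and> j \<le> n},
      Src = (\<lambda>e. case e of LeftLeg i j \<Rightarrow> Base i | RightLeg i j \<Rightarrow> Base j),
      Tgt = (\<lambda>e. case e of LeftLeg i j \<Rightarrow> Apex i j | RightLeg i j \<Rightarrow> Apex i j),
      ObjAt = (\<lambda>v. case v of Base i \<Rightarrow> B i | Apex i j \<Rightarrow> D i j),
      ArrAt = (\<lambda>e. case e of LeftLeg i j \<Rightarrow> p i j | RightLeg i j \<Rightarrow> q i j)\<rparr>"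

definition pairwise_cone ::
  "('o, 'm) category_data \<Rightarrow> (nat \<Rightarrow> 'm) \<Rightarrow> (nat \<Rightarrow> nat \<Rightarrow> 'm) \<Rightarrow> pairwise_node \<Rightarrow> 'm" where
  "pairwise_cone C r p v = (case v of Base i \<Rightarrow> r i | Apex i j \<Rightarrow> p i j \<odot>\<^bsub>C\<^esub> r i)"

end

theory Submission
  imports Defs
begin

text \<open>
  The condition on \<open>n\<close>-tuples is a Chinese remainder theorem: elements \<open>b\<^sub>i\<close> of \<open>B\<^sub>i\<close> that agree in the
  pairwise pushouts lift, locally, to an element of \<open>X\<close>.  In an exact Mal'tsev category the pushout of
  \<open>r\<^sub>i\<close> and \<open>r\<^sub>j\<close> is the quotient by the composite of their kernels \<open>R\<^sub>i\<close> and \<open>R\<^sub>j\<close>; so, as in the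
  classical theorem for ideals, lifts are built one index at a time, using the dual distributive law
  \<open>\<And>\<^sub>i (R\<^sub>i \<or> S) = (\<And>\<^sub>i R\<^sub>i) \<or> S\<close>.

  Conversely, let \<open>d, c : R \<rightarrow> X\<close> be the legs of a reflexive relation.  They have a common section, so
  the two coprojections of their pushout agree, and the remainder theorem for \<open>(d, c, c)\<close> says that
  \<open>R\<close> is the kernel pair of this coprojection: hence exactness and the Mal'tsev property.  If
  \<open>a R b\<close> and \<open>a (S \<circ> T) b\<close>, the remainder theorem for the quotients by \<open>R, S, T\<close> and the classes
  of \<open>a, a, b\<close> gives \<open>w\<close> with \<open>a (R \<inter> S) w (R \<inter> T) b\<close>: hence distributivity.
\<close>

section \<open>Regular epimorphisms\<close>

text \<open>The obstacle is that elements exist only locally: regular epimorphisms need not split,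
  so every lift and every intermediate element costs a cover, i.e. a regular epimorphism onto the
  stage of definition. Two mechanisms dispose of such covers. A pair lies in a relation as soon as
  it does so over a cover (\<open>related_descent\<close>), and a morphism is a regular epimorphism
  as soon as some composite ending with it is one (\<open>regular_epi_left_factor\<close>). By the
  second, the comparison morphism is settled by lifting a single family, the projections of the
  limit itself.

  Exactness and the Mal'tsev property involve only two distinct quotients, whence the repeated
  \<open>c\<close>; the third index serves distributivity, where the point \<open>w\<close> is tied
  to three quotients at once.

  Distributivity is stated for quotient maps instead of lattice elements
  (\<open>kernels_distribute\<close>). In this form it makes sense before the equivalence relations
  are known to form a lattice, and both directions meet in it. The price is a dictionary between
  equivalence relations, their sets of generalized elements, and regular epimorphisms.\<close>

context category
begin

lemma Hom_iff [simp]: "f \<in> Hom C A B \<longleftrightarrow> f \<in> Arr C \<and> Dom C f = A \<and> Cod C f = B"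
  by (simp add: Hom_def)

lemma Comp_simps [simp]:
  assumes "f \<in> Arr C" "g \<in> Arr C" "Dom C g = Cod C f"
  shows "g \<odot> f \<in> Arr C" "Dom C (g \<odot> f) = Dom C f" "Cod C (g \<odot> f) = Cod C g"
  using Comp_Hom[of f "Dom C f" "Cod C f" g "Cod C g"] assms by auto

lemma Comp_assoc' [simp]:
  assumes "f \<in> Arr C" "g \<in> Arr C" "h \<in> Arr C" "Dom C g = Cod C f" "Dom C h = Cod C g"
  shows "(h \<odot> g) \<odot> f = h \<odot> (g \<odot> f)"
  using Comp_assoc[of f "Dom C f" "Cod C f" g "Cod C g" h "Cod C h"] assms by auto

lemma Id_simps [simp]:
  assumes "A \<in> Obj C"
  shows "Id C A \<in> Arr C" "Dom C (Id C A) = A" "Cod C (Id C A) = A"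
  using Id_Hom[OF assms] by auto

lemma Comp_Id' [simp]: "f \<in> Arr C \<Longrightarrow> Dom C f = X \<Longrightarrow> f \<odot> Id C X = f"
  using Comp_Id by auto

lemma Id_Comp' [simp]: "f \<in> Arr C \<Longrightarrow> Cod C f = X \<Longrightarrow> Id C X \<odot> f = f"
  using Id_Comp by auto

lemma Obj_simps [simp]: "f \<in> Arr C \<Longrightarrow> Dom C f \<in> Obj C" "f \<in> Arr C \<Longrightarrow> Cod C f \<in> Obj C"
  by (auto intro: Dom_Obj Cod_Obj)

lemma Comp_cong_right:
  assumes "g \<odot> f = g' \<odot> f'" "f \<in> Arr C" "g \<in> Arr C" "f' \<in> Arr C" "g' \<in> Arr C"
    "Dom C g = Cod C f" "Dom C g' = Cod C f'" "x \<in> Arr C" "Cod C x = Dom C f"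
    "Dom C f' = Dom C f"
  shows "g \<odot> (f \<odot> x) = g' \<odot> (f' \<odot> x)"
  using assms by (metis Comp_assoc')

lemma Comp_rewrite:
  assumes "g \<odot> f = k" "f \<in> Arr C" "g \<in> Arr C" "Dom C g = Cod C f" "x \<in> Arr C" "Cod C x = Dom C f"
  shows "g \<odot> (f \<odot> x) = k \<odot> x"
  using assms by (metis Comp_assoc')

lemma regular_epiE:
  assumes "regular_epi C e"
  obtains u v where "is_coequalizer C u v e"
  using assms by (auto simp: regular_epi_def)

lemma regular_epi_Arr [simp]: "regular_epi C e \<Longrightarrow> e \<in> Arr C"
  by (auto simp: regular_epi_def is_coequalizer_def)

lemma regular_epi_cancel:
  assumes "regular_epi C e" "f \<odot> e = g \<odot> e" "f \<in> Arr C" "g \<in> Arr C" "Dom C f = Cod C e" "Dom C g = Cod C e"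
  shows "f = g"
proof -
  obtain u v where uv: "is_coequalizer C u v e" using assms regular_epiE by blast
  have e: "e \<in> Arr C" "u \<in> Arr C" "v \<in> Arr C" "Cod C u = Dom C e" "Cod C v = Dom C e"
    "Dom C u = Dom C v"
    and eq: "e \<odot> u = e \<odot> v"
    using uv by (auto simp: is_coequalizer_def)
  \<comment> \<open>Equality of the codomains of \<open>f\<close> and \<open>g\<close> is not
    assumed; both are the codomain of the common composite.\<close>
  have "Cod C (f \<odot> e) = Cod C f" "Cod C (g \<odot> e) = Cod C g" using assms(3-6) e by auto
  then have cod: "Cod C f = Cod C g" using assms(2) by simp
  have "(f \<odot> e) \<odot> u = (f \<odot> e) \<odot> v" using assms(3-6) e eq by simp
  moreover have "f \<odot> e \<in> Hom C (Cod C u) (Cod C f)" using assms(3-6) e by simp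
  ultimately have "\<exists>!h. h \<in> Hom C (Cod C e) (Cod C f) \<and> h \<odot> e = f \<odot> e"
    using uv unfolding is_coequalizer_def by blast
  moreover have "f \<in> Hom C (Cod C e) (Cod C f)" "g \<in> Hom C (Cod C e) (Cod C f)"
    using assms(3-6) cod by auto
  ultimately show ?thesis using assms(2) by (metis (no_types))
qed

lemma coequalizer_factor:
  assumes "is_coequalizer C u v e" "a \<in> Arr C" "Dom C a = Cod C u" "a \<odot> u = a \<odot> v"
  obtains h where "h \<in> Hom C (Cod C e) (Cod C a)" "h \<odot> e = a"
  using assms unfolding is_coequalizer_def by (metis Hom_iff)

lemma monic_cancel:
  assumes "monic C m" "m \<odot> a = m \<odot> b" "a \<in> Arr C" "b \<in> Arr C" "Dom C a = Dom C b"
    "Cod C a = Dom C m" "Cod C b = Dom C m"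
  shows "a = b"
  using assms by (auto simp: monic_def)

lemma monic_Arr [simp]: "monic C m \<Longrightarrow> m \<in> Arr C"
  by (simp add: monic_def)

lemma pullbackD:
  assumes "is_pullback C f g p q"
  shows "f \<in> Arr C" "g \<in> Arr C" "Cod C f = Cod C g" "p \<in> Arr C" "q \<in> Arr C" "Dom C q = Dom C p"
    "Cod C p = Dom C f" "Cod C q = Dom C g" "f \<odot> p = g \<odot> q"
  using assms by (auto simp: is_pullback_def)

lemma pullback_lift:
  assumes "is_pullback C f g p q" "a \<in> Arr C" "b \<in> Arr C" "Dom C a = Dom C b"
    "Cod C a = Dom C f" "Cod C b = Dom C g" "f \<odot> a = g \<odot> b"
  obtains h where "h \<in> Hom C (Dom C a) (Dom C p)" "p \<odot> h = a" "q \<odot> h = b"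
proof -
  have "\<exists>!h. h \<in> Hom C (Dom C a) (Dom C p) \<and> p \<odot> h = a \<and> q \<odot> h = b"
    using assms unfolding is_pullback_def by (metis Hom_iff)
  then show ?thesis using that by blast
qed

lemma pullback_unique:
  assumes pb: "is_pullback C f g p q" and h: "h \<in> Arr C" "k \<in> Arr C" "Dom C h = Dom C k"
    "Cod C h = Dom C p" "Cod C k = Dom C p" "p \<odot> h = p \<odot> k" "q \<odot> h = q \<odot> k"
  shows "h = k"
proof -
  note D = pullbackD[OF pb]
  have "f \<odot> (p \<odot> h) = g \<odot> (q \<odot> h)" using D h by (intro Comp_cong_right) auto
  then have "\<exists>!x. x \<in> Hom C (Dom C h) (Dom C p) \<and> p \<odot> x = p \<odot> h \<and> q \<odot> x = q \<odot> h"
    using pb D h unfolding is_pullback_def by (metis Comp_simps Hom_iff)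
  then show ?thesis using h by auto
qed

lemma productD:
  assumes "is_product C A B P p q"
  shows "p \<in> Arr C" "q \<in> Arr C" "Dom C p = P" "Dom C q = P" "Cod C p = A" "Cod C q = B"
  using assms by (auto simp: is_product_def)

lemma product_lift:
  assumes "is_product C A B P p q" "f \<in> Arr C" "g \<in> Arr C" "Cod C f = A" "Cod C g = B" "Dom C f = Dom C g"
  obtains h where "h \<in> Hom C (Dom C f) P" "p \<odot> h = f" "q \<odot> h = g"
proof -
  have "\<exists>!h. h \<in> Hom C (Dom C f) P \<and> p \<odot> h = f \<and> q \<odot> h = g"
    using assms unfolding is_product_def by (metis Hom_iff)
  then show ?thesis using that by blast
qed

lemma product_unique:
  assumes pr: "is_product C A B P p q" and h: "h \<in> Arr C" "k \<in> Arr C" "Dom C h = Dom C k"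
    "Cod C h = P" "Cod C k = P" "p \<odot> h = p \<odot> k" "q \<odot> h = q \<odot> k"
  shows "h = k"
proof -
  note D = productD[OF pr]
  have "\<exists>!x. x \<in> Hom C (Dom C h) P \<and> p \<odot> x = p \<odot> h \<and> q \<odot> x = q \<odot> h"
    using pr D h unfolding is_product_def by (metis Comp_simps Hom_iff)
  then show ?thesis using h by auto
qed

end

text \<open>The axiom speaks of diagrams indexed by natural numbers only; a finite diagram of any
  shape is transported to one of these along injections of its nodes and edges.\<close>

lemma (in finitely_complete_category) limit_exists:
  fixes G :: "('v, 'e, 'a, 'b) diagram"
  assumes fin: "finite (Nodes G)" "finite (Edges G)" and dia: "is_diagram C G"
  shows "\<exists>L l. is_limit C G L l"
proof -
  obtain f :: "'v \<Rightarrow> nat" where f: "inj_on f (Nodes G)"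
    using finite_imp_inj_to_nat_seg[OF fin(1)] by metis
  obtain g :: "'e \<Rightarrow> nat" where g: "inj_on g (Edges G)"
    using finite_imp_inj_to_nat_seg[OF fin(2)] by metis
  let ?f' = "inv_into (Nodes G) f" and ?g' = "inv_into (Edges G) g"
  define G' :: "(nat, nat, 'a, 'b) diagram" where
    "G' = \<lparr>Nodes = f ` Nodes G, Edges = g ` Edges G, Src = (\<lambda>e. f (Src G (?g' e))),
           Tgt = (\<lambda>e. f (Tgt G (?g' e))), ObjAt = (\<lambda>v. ObjAt G (?f' v)),
           ArrAt = (\<lambda>e. ArrAt G (?g' e))\<rparr>"
  have G'_sel: "Nodes G' = f ` Nodes G" "Edges G' = g ` Edges G"
    "\<And>e. e \<in> Edges G \<Longrightarrow> Src G' (g e) = f (Src G e)"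
    "\<And>e. e \<in> Edges G \<Longrightarrow> Tgt G' (g e) = f (Tgt G e)"
    "\<And>v. v \<in> Nodes G \<Longrightarrow> ObjAt G' (f v) = ObjAt G v"
    "\<And>e. e \<in> Edges G \<Longrightarrow> ArrAt G' (g e) = ArrAt G e"
    using f g by (auto simp: G'_def)
  have st: "Src G e \<in> Nodes G" "Tgt G e \<in> Nodes G" if "e \<in> Edges G" for e
    using dia that by (auto simp: is_diagram_def)
  have "is_diagram C G'"
    using dia unfolding is_diagram_def by (auto simp: G'_sel st)
  then obtain L l where L: "is_limit C G' L l"
    using finite_limits[of G'] fin by (auto simp: G'_sel)
  have cone: "is_cone C G' X c \<longleftrightarrow> is_cone C G X (c \<circ> f)" for X c
    by (auto simp: is_cone_def G'_sel st simp del: Hom_iff)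
  have med: "mediates C G' L l X c h \<longleftrightarrow> mediates C G L (l \<circ> f) X (c \<circ> f) h" for X c h
    by (auto simp: mediates_def G'_sel)
  have "is_limit C G L (l \<circ> f)"
    unfolding is_limit_def
  proof (intro conjI allI impI)
    show "is_cone C G L (l \<circ> f)" using L cone by (simp add: is_limit_def)
    fix X c assume c: "is_cone C G X c"
    \<comment> \<open>The transported cone, pulled back along \<open>f\<close>, agrees with
      \<open>c\<close> only on the nodes of \<open>G\<close>. Cones and mediating morphisms are not
      tested elsewhere.\<close>
    have ext: "\<And>v. v \<in> Nodes G \<Longrightarrow> (c \<circ> ?f' \<circ> f) v = c v" using f by simp
    have "is_cone C G X (c \<circ> ?f' \<circ> f)"
      using c unfolding is_cone_def by (auto simp: ext st simp del: comp_apply)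
    then have "\<exists>!h. mediates C G' L l X (c \<circ> ?f') h" using L cone by (simp add: is_limit_def)
    then have "\<exists>!h. mediates C G L (l \<circ> f) X (c \<circ> ?f' \<circ> f) h" by (simp add: med)
    moreover have "mediates C G L (l \<circ> f) X (c \<circ> ?f' \<circ> f) h = mediates C G L (l \<circ> f) X c h" for h
      unfolding mediates_def using ext by (auto simp del: comp_apply)
    ultimately show "\<exists>!h. mediates C G L (l \<circ> f) X c h" by simp
  qed
  then show ?thesis by blast
qed

section \<open>Binary products and pullbacks\<close>

context finitely_complete_category
begin

lemma product_exists:
  assumes "A \<in> Obj C" "B \<in> Obj C"
  obtains P p q where "is_product C A B P p q"
proof -
  define G :: "(bool, bool, 'a, 'b) diagram" where
    "G = \<lparr>Nodes = UNIV, Edges = {}, Src = id, Tgt = id, ObjAt = (\<lambda>v. if v then A else B),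
          ArrAt = undefined\<rparr>"
  have "is_diagram C G" using assms by (auto simp: is_diagram_def G_def)
  then obtain L l where L: "is_limit C G L l"
    using limit_exists[of G] by (auto simp: G_def)
  have cone: "is_cone C G X c \<longleftrightarrow> c True \<in> Hom C X A \<and> c False \<in> Hom C X B" for X c
    by (auto simp: is_cone_def G_def)
  have med: "mediates C G L l X c h \<longleftrightarrow> h \<in> Hom C X L \<and> l True \<odot> h = c True \<and> l False \<odot> h = c False" for X c h
    unfolding mediates_def G_def by (auto simp: all_bool_eq)
  have "is_product C A B L (l True) (l False)"
    unfolding is_product_def
  proof (intro conjI allI impI)
    show "l True \<in> Hom C L A" "l False \<in> Hom C L B"
      using L cone by (auto simp: is_limit_def)
    fix X f g assume "f \<in> Hom C X A \<and> g \<in> Hom C X B"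
    then have "is_cone C G X (\<lambda>v. if v then f else g)" by (simp add: cone)
    then have "\<exists>!h. mediates C G L l X (\<lambda>v. if v then f else g) h" using L by (simp add: is_limit_def)
    then show "\<exists>!h. h \<in> Hom C X L \<and> l True \<odot> h = f \<and> l False \<odot> h = g"
      unfolding med by simp
  qed
  then show ?thesis using that by blast
qed

lemma pullback_exists:
  assumes "f \<in> Arr C" "g \<in> Arr C" "Cod C f = Cod C g"
  obtains p q where "is_pullback C f g p q"
proof -
  \<comment> \<open>The cospan: \<open>None\<close> is its corner, and the edge \<open>b\<close>
    leads to it from the foot \<open>Some b\<close>. The component of a cone at \<open>None\<close>
    is determined by the others.\<close>
  define G :: "(bool option, bool, 'a, 'b) diagram" where
    "G = \<lparr>Nodes = UNIV, Edges = UNIV, Src = Some, Tgt = (\<lambda>_. None),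
          ObjAt = (\<lambda>v. case v of None \<Rightarrow> Cod C f | Some b \<Rightarrow> if b then Dom C f else Dom C g),
          ArrAt = (\<lambda>b. if b then f else g)\<rparr>"
  have "is_diagram C G" using assms by (auto simp: is_diagram_def G_def split: option.split)
  then obtain L l where L: "is_limit C G L l"
    using limit_exists[of G] by (auto simp: G_def)
  let ?p = "l (Some True)" and ?q = "l (Some False)"
  have cone: "is_cone C G X c \<longleftrightarrow> c (Some True) \<in> Hom C X (Dom C f) \<and> c (Some False) \<in> Hom C X (Dom C g) \<and>
     f \<odot> c (Some True) = c None \<and> g \<odot> c (Some False) = c None" for X c
  proof -
    have "c None \<in> Hom C X (Cod C f)" if "c (Some True) \<in> Hom C X (Dom C f)" "f \<odot> c (Some True) = c None"
      using Comp_Hom[OF that(1), of f "Cod C f"] that(2) assms by auto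
    then show ?thesis
      using assms unfolding is_cone_def G_def by (auto simp: all_bool_eq split_option_all)
  qed
  have l: "?p \<in> Hom C L (Dom C f)" "?q \<in> Hom C L (Dom C g)" "f \<odot> ?p = l None" "g \<odot> ?q = l None"
    using L cone by (auto simp: is_limit_def)
  have med: "mediates C G L l X c h \<longleftrightarrow> h \<in> Hom C X L \<and> ?p \<odot> h = c (Some True) \<and> ?q \<odot> h = c (Some False)"
    if "is_cone C G X c" for X c h
  proof -
    have "l None \<odot> h = c None" if "h \<in> Hom C X L" "?p \<odot> h = c (Some True)"
      using that \<open>is_cone C G X c\<close> l assms by (auto simp: cone simp flip: l(3))
    then show ?thesis unfolding mediates_def G_def by (auto simp: split_option_all all_bool_eq)
  qed
  have "is_pullback C f g ?p ?q"
    unfolding is_pullback_def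
  proof (intro conjI allI impI)
    fix X a b assume ab: "a \<in> Hom C X (Dom C f) \<and> b \<in> Hom C X (Dom C g) \<and> f \<odot> a = g \<odot> b"
    let ?c = "\<lambda>v. case v of None \<Rightarrow> f \<odot> a | Some v \<Rightarrow> if v then a else b"
    have c: "is_cone C G X ?c" using ab by (simp add: cone)
    then have "\<exists>!h. mediates C G L l X ?c h" using L by (simp add: is_limit_def)
    then show "\<exists>!h. h \<in> Hom C X (Dom C ?p) \<and> ?p \<odot> h = a \<and> ?q \<odot> h = b"
      unfolding med[OF c] using l by simp
  qed (use assms l in auto)
  then show ?thesis using that by blast
qed

end

section \<open>Local lifts, images and extremal epimorphisms\<close>

context regular_category
begin

text \<open>The form in which pullback stability is used: a generalized element \<open>b\<close> of
  the codomain of \<open>r\<close> lifts to the domain over a cover \<open>e\<close> of its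
  stage.\<close>

lemma regular_epi_lift:
  assumes "regular_epi C r" "b \<in> Arr C" "Cod C b = Cod C r"
  obtains e x where "regular_epi C e" "Cod C e = Dom C b" "x \<in> Hom C (Dom C e) (Dom C r)"
    "r \<odot> x = b \<odot> e"
proof -
  obtain p q where pb: "is_pullback C r b p q" using pullback_exists[of r b] assms by auto
  then have "regular_epi C q" using assms(1) regular_epi_pullback_stable by blast
  then show ?thesis using that[of q p] pullbackD[OF pb] by auto
qed

text \<open>The image is the quotient by the kernel pair of \<open>f\<close>. The induced
  \<open>m\<close> is monic because elements of the quotient lift locally to the domain of
  \<open>f\<close>; if \<open>m\<close> identifies them, the lifts form a point of the kernel pair,
  which \<open>e\<close> coequalizes.\<close>

lemma image_factorization:
  assumes f: "f \<in> Arr C"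
  obtains e m where "regular_epi C e" "monic C m" "Dom C e = Dom C f" "Cod C e = Dom C m"
    "Cod C m = Cod C f" "m \<odot> e = f"
proof -
  obtain p q where pb: "is_pullback C f f p q" using pullback_exists[of f f] f by auto
  note D = pullbackD[OF pb]
  obtain e where e: "is_coequalizer C p q e"
    using kernel_pair_coequalizer[of f p q] pb by (auto simp: is_kernel_pair_def)
  have re: "regular_epi C e" using e by (auto simp: regular_epi_def)
  have eD: "e \<in> Arr C" "Dom C e = Dom C f" "e \<odot> p = e \<odot> q"
    using e D by (auto simp: is_coequalizer_def)
  obtain m where m: "m \<in> Hom C (Cod C e) (Cod C f)" "m \<odot> e = f"
    using coequalizer_factor[OF e, of f] D by auto
  have "monic C m"
    unfolding monic_def
  proof (intro conjI allI impI)
    fix X a b assume ab: "a \<in> Hom C X (Dom C m) \<and> b \<in> Hom C X (Dom C m) \<and> m \<odot> a = m \<odot> b"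
    obtain e1 x where 1: "regular_epi C e1" "Cod C e1 = Dom C a" "x \<in> Hom C (Dom C e1) (Dom C e)"
      "e \<odot> x = a \<odot> e1" using regular_epi_lift[OF re, of a] ab m by auto
    \<comment> \<open>The second lift is taken over the cover of the first, so that both are
      available over \<open>e1 \<odot> e2\<close>.\<close>
    obtain e2 y where 2: "regular_epi C e2" "Cod C e2 = Dom C e1" "y \<in> Hom C (Dom C e2) (Dom C e)"
      "e \<odot> y = (b \<odot> e1) \<odot> e2"
      using regular_epi_lift[OF re, of "b \<odot> e1"] ab m 1 by auto
    have "f \<odot> (x \<odot> e2) = m \<odot> (e \<odot> (x \<odot> e2))"
      by (rule Comp_rewrite[OF m(2), symmetric]) (use m(1) eD 1(1-3) 2(1-3) in auto)
    also have "e \<odot> (x \<odot> e2) = a \<odot> (e1 \<odot> e2)"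
      by (rule Comp_cong_right[OF 1(4)]) (use ab m eD 1 2(1-3) in auto)
    also have "m \<odot> (a \<odot> (e1 \<odot> e2)) = m \<odot> (b \<odot> (e1 \<odot> e2))"
      by (rule Comp_cong_right) (use ab m eD 1(1-3) 2(1-3) in auto)
    also have "\<dots> = m \<odot> (e \<odot> y)"
      using 2 1(1-3) ab m eD by simp
    also have "\<dots> = f \<odot> y"
      by (rule Comp_rewrite[OF m(2)]) (use m(1) eD 2(1-3) in auto)
    finally obtain h where h: "h \<in> Hom C (Dom C e2) (Dom C p)" "p \<odot> h = x \<odot> e2" "q \<odot> h = y"
      using pullback_lift[OF pb, of "x \<odot> e2" y] D eD 1(1-3) 2(1-3) by auto
    have "e \<odot> (p \<odot> h) = e \<odot> (q \<odot> h)"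
      by (rule Comp_cong_right) (use D eD h(1) in auto)
    then have "e \<odot> (x \<odot> e2) = e \<odot> y" using h by simp
    then have "(a \<odot> e1) \<odot> e2 = (b \<odot> e1) \<odot> e2"
      using 2(4) \<open>e \<odot> (x \<odot> e2) = a \<odot> (e1 \<odot> e2)\<close> ab 1(1-3) 2(1-3) m by simp
    then have "a \<odot> e1 = b \<odot> e1"
      by (rule regular_epi_cancel[OF 2(1)]) (use ab 1(1-3) 2(1-3) m in auto)
    then show "a = b"
      by (rule regular_epi_cancel[OF 1(1)]) (use ab 1(1-3) 2(1-3) m in auto)
  qed (use m in auto)
  then show ?thesis using that[of e m] re eD m by auto
qed

text \<open>Since \<open>m\<close> is monic, \<open>u\<close> coequalizes the pair whose coequalizer
  is \<open>e\<close>.\<close>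

lemma regular_epi_monic_diagonal:
  assumes e: "regular_epi C e" and m: "monic C m" and eq: "m \<odot> u = v \<odot> e"
    and uv: "u \<in> Hom C (Dom C e) (Dom C m)" "v \<in> Hom C (Cod C e) (Cod C m)"
  obtains d where "d \<in> Hom C (Cod C e) (Dom C m)" "d \<odot> e = u" "m \<odot> d = v"
proof -
  obtain s t where st: "is_coequalizer C s t e" using e regular_epiE by blast
  have S: "s \<in> Arr C" "t \<in> Arr C" "Dom C t = Dom C s" "Cod C t = Cod C s" "Dom C e = Cod C s"
    "e \<in> Arr C" "e \<odot> s = e \<odot> t"
    using st by (auto simp: is_coequalizer_def)
  have mA: "m \<in> Arr C" using m by simp
  have "m \<odot> (u \<odot> s) = v \<odot> (e \<odot> s)" by (rule Comp_cong_right[OF eq]) (use uv S mA in auto)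
  also have "\<dots> = v \<odot> (e \<odot> t)" using S by simp
  also have "\<dots> = m \<odot> (u \<odot> t)" by (rule Comp_cong_right[OF eq[symmetric]]) (use uv S mA in auto)
  finally have "u \<odot> s = u \<odot> t"
    by (rule monic_cancel[OF m]) (use uv S in auto)
  then obtain d where d: "d \<in> Hom C (Cod C e) (Dom C m)" "d \<odot> e = u"
    using coequalizer_factor[OF st, of u] uv S by auto
  have "(m \<odot> d) \<odot> e = v \<odot> e" using d uv S mA eq by simp
  then have "m \<odot> d = v"
    by (rule regular_epi_cancel[OF e]) (use d uv mA in auto)
  then show ?thesis using that d by blast
qed

text \<open>The right-hand side is extremality: a monomorphism through which \<open>f\<close>
  factors has a right inverse, hence is invertible. It makes no mention of a coequalized pair, so
  closure under composition and under left factors can be read off from it.\<close>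

lemma regular_epi_iff_extremal:
  assumes f: "f \<in> Arr C"
  shows "regular_epi C f \<longleftrightarrow>
    (\<forall>m g. monic C m \<and> g \<in> Hom C (Dom C f) (Dom C m) \<and> m \<odot> g = f \<longrightarrow>
       (\<exists>d\<in>Hom C (Cod C m) (Dom C m). m \<odot> d = Id C (Cod C m)))"
    (is "_ \<longleftrightarrow> ?R")
proof
  assume r: "regular_epi C f"
  show ?R
  proof (intro allI impI)
    fix m g assume mg: "monic C m \<and> g \<in> Hom C (Dom C f) (Dom C m) \<and> m \<odot> g = f"
    then have mA: "m \<in> Arr C" by simp
    have cod: "Cod C f = Cod C m" using mg mA by auto
    have "m \<odot> g = Id C (Cod C f) \<odot> f" using mg f by simp
    then obtain d where "d \<in> Hom C (Cod C f) (Dom C m)" "m \<odot> d = Id C (Cod C f)"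
      using regular_epi_monic_diagonal[OF r, of m g "Id C (Cod C f)"] mg mA f cod by auto
    then show "\<exists>d\<in>Hom C (Cod C m) (Dom C m). m \<odot> d = Id C (Cod C m)" using cod by auto
  qed
next
  assume R: ?R
  obtain e m where em: "regular_epi C e" "monic C m" "Dom C e = Dom C f" "Cod C e = Dom C m"
    "Cod C m = Cod C f" "m \<odot> e = f" using image_factorization[OF f] by blast
  have A: "e \<in> Arr C" "m \<in> Arr C" using em by auto
  obtain d where d: "d \<in> Hom C (Cod C m) (Dom C m)" "m \<odot> d = Id C (Cod C m)"
    using R em A by (metis Hom_iff)
  obtain u v where uv: "is_coequalizer C u v e" using em regular_epiE by blast
  have S: "u \<in> Arr C" "v \<in> Arr C" "Dom C v = Dom C u" "Cod C v = Cod C u" "Cod C u = Dom C e"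
    "e \<odot> u = e \<odot> v"
    using uv by (auto simp: is_coequalizer_def)
  \<comment> \<open>The image inclusion \<open>m\<close> is thus invertible, and \<open>f\<close>
    is, like \<open>e\<close>, a coequalizer of \<open>u\<close> and \<open>v\<close>.\<close>
  have "m \<odot> (d \<odot> m) = m \<odot> Id C (Dom C m)"
    using Comp_rewrite[OF d(2), of m] d(1) A by simp
  then have dm: "d \<odot> m = Id C (Dom C m)"
    by (rule monic_cancel[OF em(2)]) (use d A in auto)
  have "is_coequalizer C u v f"
    unfolding is_coequalizer_def
  proof (intro conjI allI impI)
    have "m \<odot> (e \<odot> u) = m \<odot> (e \<odot> v)" using S by simp
    then show "f \<odot> u = f \<odot> v" unfolding em(6)[symmetric] using S A em(4) by simp
    fix Y a assume a: "a \<in> Hom C (Cod C u) Y \<and> a \<odot> u = a \<odot> v"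
    then obtain h where h: "h \<in> Hom C (Cod C e) Y" "h \<odot> e = a"
      using coequalizer_factor[OF uv, of a] by auto
    have "(h \<odot> d) \<odot> f = h \<odot> (d \<odot> (m \<odot> e))"
      unfolding em(6)[symmetric] using h(1) d(1) A em(3-5) by simp
    also have "d \<odot> (m \<odot> e) = e"
      using Comp_rewrite[OF dm, of e] d(1) A em(3-5) by simp
    finally have 1: "(h \<odot> d) \<odot> f = a" using h by simp
    have unique: "k = k'" if "k \<in> Hom C (Cod C f) Y" "k' \<in> Hom C (Cod C f) Y"
      "k \<odot> f = k' \<odot> f" for k k'
    proof -
      have "(k \<odot> m) \<odot> e = (k' \<odot> m) \<odot> e"
        using that em(3-6) A by simp
      then have "k \<odot> m = k' \<odot> m"
        by (rule regular_epi_cancel[OF em(1)]) (use that em(3-5) A in auto)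
      then have "k \<odot> (m \<odot> d) = k' \<odot> (m \<odot> d)"
        by (rule Comp_cong_right) (use that(1,2) em(3-5) A d in auto)
      then show ?thesis using d that em(5) by simp
    qed
    show "\<exists>!h. h \<in> Hom C (Cod C f) Y \<and> h \<odot> f = a"
    proof (rule ex1I)
      show "h \<odot> d \<in> Hom C (Cod C f) Y \<and> (h \<odot> d) \<odot> f = a" using 1 h d A em(3-5) by auto
      then show "k = h \<odot> d" if "k \<in> Hom C (Cod C f) Y \<and> k \<odot> f = a" for k
        using unique[of k "h \<odot> d"] that by metis
    qed
  qed (use S A f em(3-5) in auto)
  then show "regular_epi C f" by (auto simp: regular_epi_def)
qed

lemma regular_epi_comp:
  assumes f: "regular_epi C f" and g: "regular_epi C g" and fg: "Dom C g = Cod C f"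
  shows "regular_epi C (g \<odot> f)"
proof -
  have A: "f \<in> Arr C" "g \<in> Arr C" using assms by auto
  have "\<exists>d\<in>Hom C (Cod C m) (Dom C m). m \<odot> d = Id C (Cod C m)"
    if m: "monic C m" "h \<in> Hom C (Dom C (g \<odot> f)) (Dom C m)" "m \<odot> h = g \<odot> f" for m h
  proof -
    have mA: "m \<in> Arr C" using m by simp
    have "Cod C (m \<odot> h) = Cod C (g \<odot> f)" using m by simp
    then have cod: "Cod C m = Cod C g" using mA m(2) A fg by simp
    obtain d where d: "d \<in> Hom C (Cod C f) (Dom C m)" "m \<odot> d = g"
      using regular_epi_monic_diagonal[OF f m(1) m(3)] m(2) A fg cod by auto
    have "m \<odot> d = Id C (Cod C g) \<odot> g" using d A by simp
    then obtain d' where "d' \<in> Hom C (Cod C g) (Dom C m)" "m \<odot> d' = Id C (Cod C g)"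
      using regular_epi_monic_diagonal[OF g m(1), of d "Id C (Cod C g)"] A fg cod d by auto
    then show ?thesis using cod by auto
  qed
  then show ?thesis using A fg by (subst regular_epi_iff_extremal) auto
qed

lemma regular_epi_left_factor:
  assumes "regular_epi C (g \<odot> f)" and A: "f \<in> Arr C" "g \<in> Arr C" "Dom C g = Cod C f"
  shows "regular_epi C g"
proof -
  have "\<exists>d\<in>Hom C (Cod C m) (Dom C m). m \<odot> d = Id C (Cod C m)"
    if m: "monic C m" "h \<in> Hom C (Dom C g) (Dom C m)" "m \<odot> h = g" for m h
  proof -
    have "m \<in> Arr C" using m by simp
    then have "m \<odot> (h \<odot> f) = g \<odot> f" using Comp_rewrite[OF m(3), of f] m(2) A by simp
    moreover have "h \<odot> f \<in> Hom C (Dom C (g \<odot> f)) (Dom C m)" using m A by simp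
    ultimately show ?thesis
      using assms(1) m(1) regular_epi_iff_extremal[of "g \<odot> f"] A by (metis Comp_simps(1))
  qed
  then show ?thesis using A by (subst regular_epi_iff_extremal) auto
qed

lemma regular_epi_Id: "A \<in> Obj C \<Longrightarrow> regular_epi C (Id C A)"
  unfolding regular_epi_def is_coequalizer_def
  by (intro exI[of _ "Id C A"]) auto

lemma split_epi_regular:
  assumes "f \<odot> s = Id C A" "A \<in> Obj C" "f \<in> Arr C" "s \<in> Arr C" "Dom C f = Cod C s"
  shows "regular_epi C f"
  using regular_epi_left_factor[of f s] regular_epi_Id assms by simp

end

section \<open>Relations and generalized elements\<close>

text \<open>
  Relations and composites of kernels are described by their generalized elements, i.e. by pairs
  of parallel morphisms \<open>a, b : T \<rightarrow> X\<close>; an existential statement holds locally, after composition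
  with a regular epimorphism onto \<open>T\<close>.
\<close>

definition related :: "('o, 'm) category_data \<Rightarrow> 'm \<Rightarrow> 'm \<Rightarrow> 'm \<Rightarrow> 'm \<Rightarrow> 'm \<Rightarrow> bool" where
  "related C p q m a b \<longleftrightarrow>
     (\<exists>h\<in>Hom C (Dom C a) (Dom C m). (p \<odot>\<^bsub>C\<^esub> m) \<odot>\<^bsub>C\<^esub> h = a \<and> (q \<odot>\<^bsub>C\<^esub> m) \<odot>\<^bsub>C\<^esub> h = b)"

definition kernel_composite :: "('o, 'm) category_data \<Rightarrow> 'm \<Rightarrow> 'm \<Rightarrow> 'm \<Rightarrow> 'm \<Rightarrow> bool" where
  "kernel_composite C f g a b \<longleftrightarrow>
     (\<exists>e z. regular_epi C e \<and> Cod C e = Dom C a \<and> z \<in> Hom C (Dom C e) (Dom C f) \<and>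
        f \<odot>\<^bsub>C\<^esub> (a \<odot>\<^bsub>C\<^esub> e) = f \<odot>\<^bsub>C\<^esub> z \<and> g \<odot>\<^bsub>C\<^esub> z = g \<odot>\<^bsub>C\<^esub> (b \<odot>\<^bsub>C\<^esub> e))"

context category
begin

lemma relationD:
  assumes "is_relation C X P p q m"
  shows "is_product C X X P p q" "monic C m" "m \<in> Arr C" "Cod C m = P"
    "p \<in> Arr C" "q \<in> Arr C" "Dom C p = P" "Dom C q = P" "Cod C p = X" "Cod C q = X"
  using assms by (auto simp: is_relation_def dest: productD)

lemma relation_legs_cancel:
  assumes R: "is_relation C X P p q m"
    and h: "h \<in> Arr C" "k \<in> Arr C" "Dom C h = Dom C k" "Cod C h = Dom C m" "Cod C k = Dom C m"
    and "(p \<odot> m) \<odot> h = (p \<odot> m) \<odot> k" "(q \<odot> m) \<odot> h = (q \<odot> m) \<odot> k"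
  shows "h = k"
proof -
  note D = relationD[OF R]
  have "m \<odot> h = m \<odot> k"
    by (rule product_unique[OF D(1)]) (use assms D in auto)
  then show ?thesis by (rule monic_cancel[OF D(2)]) (use h in auto)
qed

lemma related_legs:
  assumes R: "is_relation C X P p q m" and h: "h \<in> Arr C" "Cod C h = Dom C m"
  shows "related C p q m ((p \<odot> m) \<odot> h) ((q \<odot> m) \<odot> h)"
  using assms relationD[OF R] unfolding related_def by auto

text \<open>A Yoneda argument: for the converse, inclusion is tested on the universal related pair,
  which consists of the two legs of \<open>m\<close>.\<close>

lemma subobject_le_iff_related:
  assumes R: "is_relation C X P p q m" and R': "is_relation C X P p q m'"
  shows "subobject_le C m m' \<longleftrightarrow>
    (\<forall>T a b. a \<in> Hom C T X \<and> b \<in> Hom C T X \<and> related C p q m a b \<longrightarrow> related C p q m' a b)"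
proof -
  note D = relationD[OF R] and D' = relationD[OF R']
  show ?thesis
  proof (intro iffI allI impI)
    fix T a b
    assume le: "subobject_le C m m'" and ab: "a \<in> Hom C T X \<and> b \<in> Hom C T X \<and> related C p q m a b"
    obtain k where k: "k \<in> Hom C (Dom C m) (Dom C m')" "m = m' \<odot> k"
      using le unfolding subobject_le_def by metis
    obtain h where h: "h \<in> Hom C T (Dom C m)" "a = (p \<odot> m) \<odot> h" "b = (q \<odot> m) \<odot> h"
      using ab by (auto simp: related_def simp del: Comp_assoc')
    have "a = (p \<odot> m') \<odot> (k \<odot> h)" "b = (q \<odot> m') \<odot> (k \<odot> h)"
      unfolding h(2,3) using h(1) k(1) D D' by (auto simp: Comp_rewrite[OF k(2)[symmetric]])
    then show "related C p q m' a b" using related_legs[OF R', of "k \<odot> h"] h(1) k(1) by simp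
  next
    assume le: "\<forall>T a b. a \<in> Hom C T X \<and> b \<in> Hom C T X \<and> related C p q m a b \<longrightarrow> related C p q m' a b"
    have "related C p q m (p \<odot> m) (q \<odot> m)" using related_legs[OF R, of "Id C (Dom C m)"] D by simp
    then have "related C p q m' (p \<odot> m) (q \<odot> m)" using le D by simp
    then obtain h where h: "h \<in> Hom C (Dom C m) (Dom C m')" "(p \<odot> m') \<odot> h = p \<odot> m" "(q \<odot> m') \<odot> h = q \<odot> m"
      using D by (auto simp: related_def simp del: Comp_assoc')
    have "m' \<odot> h = m" by (rule product_unique[OF D(1)]) (use h D D' in auto)
    then show "subobject_le C m m'" using h by (auto simp: subobject_le_def)
  qed
qed

lemma related_iff_kernel:
  assumes R: "is_relation C X P p q m" and k: "is_kernel_pair C f (p \<odot> m) (q \<odot> m)"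
    and a: "a \<in> Hom C T X" "b \<in> Hom C T X"
  shows "related C p q m a b \<longleftrightarrow> f \<odot> a = f \<odot> b"
proof
  note D = relationD[OF R]
  have pb: "is_pullback C f f (p \<odot> m) (q \<odot> m)" using k by (simp add: is_kernel_pair_def)
  note E = pullbackD[OF pb]
  { assume "related C p q m a b"
    then obtain h where h: "h \<in> Hom C T (Dom C m)" "a = (p \<odot> m) \<odot> h" "b = (q \<odot> m) \<odot> h"
      using a by (auto simp: related_def simp del: Comp_assoc')
    show "f \<odot> a = f \<odot> b"
      unfolding h(2,3) by (rule Comp_cong_right[OF E(9)]) (use h(1) D E in auto)
  next
    assume "f \<odot> a = f \<odot> b"
    then obtain h where "h \<in> Hom C T (Dom C (p \<odot> m))" "(p \<odot> m) \<odot> h = a" "(q \<odot> m) \<odot> h = b"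
      using pullback_lift[OF pb, of a b] a D E by auto
    then show "related C p q m a b" using a D by (auto simp: related_def simp del: Comp_assoc') }
qed

text \<open>Generalized elements determine a kernel pair: existence of factorizations is relatedness
  itself, and uniqueness holds because the legs of a relation are jointly monic.\<close>

lemma kernel_pair_of_related:
  assumes R: "is_relation C X P p q m" and f: "f \<in> Arr C" "Dom C f = X"
    and rel: "\<And>T a b. a \<in> Hom C T X \<Longrightarrow> b \<in> Hom C T X \<Longrightarrow> related C p q m a b \<longleftrightarrow> f \<odot> a = f \<odot> b"
  shows "is_kernel_pair C f (p \<odot> m) (q \<odot> m)"
  unfolding is_kernel_pair_def is_pullback_def
proof (intro conjI allI impI)
  note D = relationD[OF R]
  have "related C p q m (p \<odot> m) (q \<odot> m)" using related_legs[OF R, of "Id C (Dom C m)"] D by simp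
  then show "f \<odot> (p \<odot> m) = f \<odot> (q \<odot> m)" using rel[of "p \<odot> m" "Dom C m" "q \<odot> m"] D by simp
  fix T a b assume ab: "a \<in> Hom C T (Dom C f) \<and> b \<in> Hom C T (Dom C f) \<and> f \<odot> a = f \<odot> b"
  then have "related C p q m a b" using rel f by simp
  then obtain h where h: "h \<in> Hom C T (Dom C m)" "(p \<odot> m) \<odot> h = a" "(q \<odot> m) \<odot> h = b"
    using ab by (auto simp: related_def simp del: Comp_assoc')
  have "k = h" if "k \<in> Hom C T (Dom C m)" "(p \<odot> m) \<odot> k = a" "(q \<odot> m) \<odot> k = b" for k
    by (rule relation_legs_cancel[OF R]) (use that(1) h(1) in simp, use that(1) h(1) in simp,
        use that(1) h(1) in simp, use that(1) in simp, use h(1) in simp, simp only: that h, simp only: that h)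
  moreover have "Dom C (p \<odot> m) = Dom C m" using D by simp
  ultimately show "\<exists>!h. h \<in> Hom C T (Dom C (p \<odot> m)) \<and> (p \<odot> m) \<odot> h = a \<and> (q \<odot> m) \<odot> h = b"
    using h by metis
qed (use f relationD[OF R] in auto)

text \<open>The three properties are inherited from equality after composition with
  \<open>f\<close>. Each is a factorization through the pullback: of the pair of identities, of the
  interchanged legs, and of the outer legs of composable pairs.\<close>

lemma kernel_pair_equivalence_relation:
  assumes R: "is_relation C X P p q m" and k: "is_kernel_pair C f (p \<odot> m) (q \<odot> m)"
  shows "is_equivalence_relation C X P p q m"
proof -
  define d c where dc: "d = p \<odot> m" "c = q \<odot> m"
  have D: "X \<in> Obj C" "d \<in> Arr C" "c \<in> Arr C" "Dom C d = Dom C m" "Dom C c = Dom C m" "Cod C d = X" "Cod C c = X"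
    unfolding dc using relationD[OF R] by auto
  have pb: "is_pullback C f f d c" using k by (simp add: is_kernel_pair_def dc)
  note E = pullbackD[OF pb]
  have fX: "Dom C f = X" using E(7) D by simp
  obtain s where s: "s \<in> Hom C X (Dom C m)" "d \<odot> s = Id C X" "c \<odot> s = Id C X"
    by (rule pullback_lift[OF pb, of "Id C X" "Id C X"]) (use D fX in auto)
  then have "is_reflexive C X p q m" unfolding is_reflexive_def dc[symmetric] by blast
  moreover obtain s' where s': "s' \<in> Hom C (Dom C m) (Dom C m)" "d \<odot> s' = c" "c \<odot> s' = d"
    by (rule pullback_lift[OF pb, of c d]) (use D fX E(9) in auto)
  then have "is_symmetric C p q m" unfolding is_symmetric_def dc[symmetric] by blast
  moreover have "is_transitive C p q m"
    unfolding is_transitive_def dc[symmetric]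
  proof (intro allI impI)
    fix a b assume ab: "is_pullback C c d a b"
    note F = pullbackD[OF ab]
    have "f \<odot> (d \<odot> a) = f \<odot> (c \<odot> a)"
      by (rule Comp_cong_right[OF E(9)]) (use F(4-8) D E(1) fX in auto)
    also have "\<dots> = f \<odot> (d \<odot> b)" using F(9) by simp
    also have "\<dots> = f \<odot> (c \<odot> b)"
      by (rule Comp_cong_right[OF E(9)]) (use F(4-8) D E(1) fX in auto)
    finally have *: "f \<odot> (d \<odot> a) = f \<odot> (c \<odot> b)" .
    obtain t where "t \<in> Hom C (Dom C a) (Dom C m)" "d \<odot> t = d \<odot> a" "c \<odot> t = c \<odot> b"
      by (rule pullback_lift[OF pb _ _ _ _ _ *]) (use F(4-8) D E(1) fX in auto)
    then show "\<exists>t\<in>Hom C (Dom C a) (Dom C m). d \<odot> t = d \<odot> a \<and> c \<odot> t = c \<odot> b" by blast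
  qed
  ultimately show ?thesis using R by (simp add: is_equivalence_relation_def)
qed

end

context finitely_complete_category
begin

text \<open>Elements of \<open>Equiv\<close> are subobjects of a prescribed product, so the kernel
  pair of \<open>f\<close> is paired into that product.\<close>

lemma kernel_relation_exists:
  assumes f: "f \<in> Arr C" "Dom C f = X" and pr: "is_product C X X P p q"
  obtains m where "is_equivalence_relation C X P p q m"
    "\<And>T a b. a \<in> Hom C T X \<Longrightarrow> b \<in> Hom C T X \<Longrightarrow> related C p q m a b \<longleftrightarrow> f \<odot> a = f \<odot> b"
proof -
  obtain u v where pb: "is_pullback C f f u v" using pullback_exists[of f f] f by auto
  note E = pullbackD[OF pb] and D = productD[OF pr]
  obtain m where m: "m \<in> Hom C (Dom C u) P" "p \<odot> m = u" "q \<odot> m = v"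
    using product_lift[OF pr, of u v] E f by auto
  have "monic C m"
    unfolding monic_def
  proof (intro conjI allI impI)
    fix T a b assume ab: "a \<in> Hom C T (Dom C m) \<and> b \<in> Hom C T (Dom C m) \<and> m \<odot> a = m \<odot> b"
    have "u \<odot> x = p \<odot> (m \<odot> x)" "v \<odot> x = q \<odot> (m \<odot> x)" if "x \<in> Hom C T (Dom C m)" for x
      using Comp_rewrite[OF m(2), of x] Comp_rewrite[OF m(3), of x] m(1) D that by auto
    then have "u \<odot> a = u \<odot> b" "v \<odot> a = v \<odot> b" using ab by (simp_all del: Hom_iff)
    then show "a = b" using pullback_unique[OF pb, of a b] ab m(1) by auto
  qed (use m in auto)
  then have R: "is_relation C X P p q m" using pr m by (simp add: is_relation_def)
  have k: "is_kernel_pair C f (p \<odot> m) (q \<odot> m)" using pb m by (simp add: is_kernel_pair_def)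
  show ?thesis
    using that kernel_pair_equivalence_relation[OF R k] related_iff_kernel[OF R k] by blast
qed

end

section \<open>Relations in a regular category: descent, quotients, composites\<close>

context regular_category
begin

text \<open>Relatedness is a local property: over the cover \<open>e\<close> there is a commutative
  square from \<open>e\<close> to the monomorphism \<open>m\<close>, and its diagonal is the
  required factorization.\<close>

lemma related_descent:
  assumes R: "is_relation C X P p q m" and e: "regular_epi C e" "Cod C e = T"
    and ab: "a \<in> Hom C T X" "b \<in> Hom C T X" and rel: "related C p q m (a \<odot> e) (b \<odot> e)"
  shows "related C p q m a b"
proof -
  note D = relationD[OF R]
  have eA: "e \<in> Arr C" using e by simp
  obtain h where h: "h \<in> Hom C (Dom C e) (Dom C m)" "(p \<odot> m) \<odot> h = a \<odot> e" "(q \<odot> m) \<odot> h = b \<odot> e"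
    using rel ab eA e(2) unfolding related_def by (auto simp del: Comp_assoc')
  obtain t where t: "t \<in> Hom C T P" "p \<odot> t = a" "q \<odot> t = b"
    using product_lift[OF D(1), of a b] ab by auto
  have te: "p \<odot> (t \<odot> e) = a \<odot> e" "q \<odot> (t \<odot> e) = b \<odot> e"
    using Comp_rewrite[OF t(2), of e] Comp_rewrite[OF t(3), of e] t(1) D eA e by auto
  have mh: "p \<odot> (m \<odot> h) = a \<odot> e" "q \<odot> (m \<odot> h) = b \<odot> e"
    using h D by auto
  have "m \<odot> h = t \<odot> e"
    by (rule product_unique[OF D(1)]) (use h(1) t(1) D(3-8) eA e te mh in auto)
  then obtain d where d: "d \<in> Hom C T (Dom C m)" "m \<odot> d = t"
    using regular_epi_monic_diagonal[OF e(1) D(2), of h t] h(1) t(1) D e by auto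
  have "(p \<odot> m) \<odot> d = a" "(q \<odot> m) \<odot> d = b"
    using d t D by auto
  then show ?thesis using d ab unfolding related_def by (auto simp del: Comp_assoc')
qed

text \<open>Effectiveness supplies some \<open>g\<close> whose kernel pair is the relation. Its
  kernel is unchanged on passing to the coequalizer \<open>f\<close> of the legs, because
  \<open>f\<close> identifies the legs and \<open>g\<close> factors through
  \<open>f\<close>.\<close>

lemma equivalence_relation_regular_kernel:
  assumes R: "is_relation C X P p q m" and eff: "is_effective C p q m"
  obtains f where "regular_epi C f" "Dom C f = X"
    "\<And>T a b. a \<in> Hom C T X \<Longrightarrow> b \<in> Hom C T X \<Longrightarrow> related C p q m a b \<longleftrightarrow> f \<odot> a = f \<odot> b"
proof -
  note D = relationD[OF R]
  obtain g where k: "is_kernel_pair C g (p \<odot> m) (q \<odot> m)" using eff by (auto simp: is_effective_def)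
  then have pb: "is_pullback C g g (p \<odot> m) (q \<odot> m)" by (simp add: is_kernel_pair_def)
  note E = pullbackD[OF pb]
  obtain f where f: "is_coequalizer C (p \<odot> m) (q \<odot> m) f" using kernel_pair_coequalizer[OF k] by blast
  then have rf: "regular_epi C f" by (auto simp: regular_epi_def)
  have F: "f \<in> Arr C" "Dom C f = X" "f \<odot> (p \<odot> m) = f \<odot> (q \<odot> m)"
    using f D by (auto simp: is_coequalizer_def)
  obtain h where h: "h \<in> Hom C (Cod C f) (Cod C g)" "h \<odot> f = g"
    using coequalizer_factor[OF f, of g] E by auto
  have "related C p q m a b \<longleftrightarrow> f \<odot> a = f \<odot> b" if ab: "a \<in> Hom C T X" "b \<in> Hom C T X" for T a b
  proof
    assume "related C p q m a b"
    then obtain k where k: "k \<in> Hom C T (Dom C m)" "a = (p \<odot> m) \<odot> k" "b = (q \<odot> m) \<odot> k"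
      using ab by (auto simp: related_def simp del: Comp_assoc')
    show "f \<odot> a = f \<odot> b"
      unfolding k(2,3) by (rule Comp_cong_right[OF F(3)]) (use k(1) D F in auto)
  next
    assume eq: "f \<odot> a = f \<odot> b"
    have "g \<odot> a = h \<odot> (f \<odot> a)" "g \<odot> b = h \<odot> (f \<odot> b)"
      using Comp_rewrite[OF h(2), of a] Comp_rewrite[OF h(2), of b] F h(1) ab by auto
    then show "related C p q m a b" using eq related_iff_kernel[OF R k ab] by simp
  qed
  then show ?thesis using that rf F by blast
qed

text \<open>Chains consisting of \<open>a\<close> and \<open>z\<close> identified by
  \<open>f\<close>, then \<open>z\<close> and \<open>b\<close> identified by \<open>g\<close>, form
  a pullback of the two kernel pairs. Its map to the product forgets \<open>z\<close> and need not
  be monic; the relation is its image, and membership in an image means that \<open>z\<close> exists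
  locally.\<close>

lemma composite_relation_exists:
  assumes f: "f \<in> Arr C" "Dom C f = X" and g: "g \<in> Arr C" "Dom C g = X"
    and pr: "is_product C X X P p q"
  obtains m where "is_relation C X P p q m"
    "\<And>T a b. a \<in> Hom C T X \<Longrightarrow> b \<in> Hom C T X \<Longrightarrow>
       related C p q m a b \<longleftrightarrow> kernel_composite C f g a b"
proof -
  note D = productD[OF pr]
  obtain u1 u2 where u: "is_pullback C f f u1 u2" using pullback_exists[of f f] f by auto
  obtain v1 v2 where v: "is_pullback C g g v1 v2" using pullback_exists[of g g] g by auto
  note U = pullbackD[OF u] and V = pullbackD[OF v]
  obtain s t where st: "is_pullback C u2 v1 s t" using pullback_exists[of u2 v1] U V f g by auto
  note S = pullbackD[OF st]
  obtain k where k: "k \<in> Hom C (Dom C s) P" "p \<odot> k = u1 \<odot> s" "q \<odot> k = v2 \<odot> t"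
    using product_lift[OF pr, of "u1 \<odot> s" "v2 \<odot> t"] U V S f g by auto
  obtain e m where em: "regular_epi C e" "monic C m" "Dom C e = Dom C k" "Cod C e = Dom C m"
    "Cod C m = Cod C k" "m \<odot> e = k" using image_factorization[of k] k by auto
  have A: "e \<in> Arr C" "m \<in> Arr C" using em by auto
  have R: "is_relation C X P p q m" using pr em k by (simp add: is_relation_def)
  have legs: "(p \<odot> m) \<odot> (e \<odot> x) = u1 \<odot> (s \<odot> x)" "(q \<odot> m) \<odot> (e \<odot> x) = v2 \<odot> (t \<odot> x)"
    if "x \<in> Hom C T (Dom C s)" for x T
  proof -
    have "m \<odot> (e \<odot> x) = k \<odot> x" using Comp_rewrite[OF em(6), of x] A em k that by simp
    moreover have "p \<odot> (k \<odot> x) = u1 \<odot> (s \<odot> x)"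
      by (rule Comp_cong_right[OF k(2)]) (use that k(1) D S U f g in auto)
    moreover have "q \<odot> (k \<odot> x) = v2 \<odot> (t \<odot> x)"
      by (rule Comp_cong_right[OF k(3)]) (use that k(1) D S U V f g in auto)
    ultimately show "(p \<odot> m) \<odot> (e \<odot> x) = u1 \<odot> (s \<odot> x)" "(q \<odot> m) \<odot> (e \<odot> x) = v2 \<odot> (t \<odot> x)"
      using A D em(3-5) k(1) that by auto
  qed
  have "related C p q m a b \<longleftrightarrow> kernel_composite C f g a b"
    if ab: "a \<in> Hom C T X" "b \<in> Hom C T X" for T a b
  proof
    assume "related C p q m a b"
    then obtain h where h: "h \<in> Hom C T (Dom C m)" "(p \<odot> m) \<odot> h = a" "(q \<odot> m) \<odot> h = b"
      using ab by (auto simp: related_def simp del: Comp_assoc')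
    obtain e' x where x: "regular_epi C e'" "Cod C e' = T" "x \<in> Hom C (Dom C e') (Dom C s)" "e \<odot> x = h \<odot> e'"
      using regular_epi_lift[OF em(1), of h] h(1) em(3,4) k(1) by auto
    have e'A: "e' \<in> Arr C" using x by simp
    have "a \<odot> e' = (p \<odot> m) \<odot> (h \<odot> e')" "b \<odot> e' = (q \<odot> m) \<odot> (h \<odot> e')"
      using Comp_rewrite[OF h(2), of e'] Comp_rewrite[OF h(3), of e'] h(1) A D em(5) k(1) x(2) e'A
      by auto
    then have eqs: "a \<odot> e' = u1 \<odot> (s \<odot> x)" "b \<odot> e' = v2 \<odot> (t \<odot> x)"
      using legs[OF x(3)] x(4) by auto
    let ?z = "u2 \<odot> (s \<odot> x)"
    have z: "?z = v1 \<odot> (t \<odot> x)"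
      by (rule Comp_cong_right[OF S(9)]) (use S U V x(3) in auto)
    have "f \<odot> (a \<odot> e') = f \<odot> ?z"
      unfolding eqs by (rule Comp_cong_right[OF U(9)]) (use S U V x(3) in auto)
    moreover have "g \<odot> ?z = g \<odot> (b \<odot> e')"
      unfolding eqs z by (rule Comp_cong_right[OF V(9)]) (use S U V x(3) in auto)
    moreover have "?z \<in> Hom C (Dom C e') (Dom C f)" using S U x(3) by simp
    ultimately show "kernel_composite C f g a b"
      using x ab unfolding kernel_composite_def by auto
  next
    assume "kernel_composite C f g a b"
    then obtain e' z where z: "regular_epi C e'" "Cod C e' = T" "z \<in> Hom C (Dom C e') X"
      "f \<odot> (a \<odot> e') = f \<odot> z" "g \<odot> z = g \<odot> (b \<odot> e')"
      using ab f unfolding kernel_composite_def by auto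
    have e'A: "e' \<in> Arr C" using z by simp
    obtain h where h: "h \<in> Hom C (Dom C e') (Dom C u1)" "u1 \<odot> h = a \<odot> e'" "u2 \<odot> h = z"
      using pullback_lift[OF u, of "a \<odot> e'" z] z ab f e'A by auto
    obtain k' where k': "k' \<in> Hom C (Dom C e') (Dom C v1)" "v1 \<odot> k' = z" "v2 \<odot> k' = b \<odot> e'"
      using pullback_lift[OF v, of z "b \<odot> e'"] z ab g e'A by auto
    obtain x where x: "x \<in> Hom C (Dom C e') (Dom C s)" "s \<odot> x = h" "t \<odot> x = k'"
      using pullback_lift[OF st, of h k'] h k' U V by auto
    have "related C p q m ((p \<odot> m) \<odot> (e \<odot> x)) ((q \<odot> m) \<odot> (e \<odot> x))"
      by (rule related_legs[OF R]) (use x(1) A em(3,4) k(1) in auto)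
    then have "related C p q m (a \<odot> e') (b \<odot> e')"
      unfolding legs[OF x(1)] x(2,3) h k' .
    then show "related C p q m a b" using related_descent[OF R z(1,2)] ab by blast
  qed
  then show ?thesis using that R by blast
qed

end

section \<open>The lattice of equivalence relations\<close>

text \<open>Replaces a subobject by a set, so that the order becomes inclusion and the equivalence
  of monomorphisms becomes equality.\<close>

definition extent :: "('o, 'm) category_data \<Rightarrow> 'o \<Rightarrow> 'm \<Rightarrow> 'm \<Rightarrow> 'm \<Rightarrow> ('m \<times> 'm) set" where
  "extent C X p q m = {(a, b). \<exists>T. a \<in> Hom C T X \<and> b \<in> Hom C T X \<and> related C p q m a b}"

definition kernel_extent :: "('o, 'm) category_data \<Rightarrow> 'm \<Rightarrow> ('m \<times> 'm) set" where
  "kernel_extent C f =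
     {(a, b). \<exists>T. a \<in> Hom C T (Dom C f) \<and> b \<in> Hom C T (Dom C f) \<and> f \<odot>\<^bsub>C\<^esub> a = f \<odot>\<^bsub>C\<^esub> b}"

text \<open>With \<open>R\<close>, \<open>S\<close>, \<open>T'\<close> the kernels of
  \<open>r\<close>, \<open>s\<close>, \<open>t\<close>, this is
  \<open>R \<and> (S \<or> T') \<le> (R \<and> S) \<or> (R \<and> T')\<close> in terms of elements,
  the join being read as composite. From \<open>a\<close> to \<open>w\<close> both \<open>R\<close>
  and \<open>S\<close> hold; that \<open>R\<close> also holds from \<open>w\<close> to
  \<open>b\<close> follows from \<open>r \<odot> a = r \<odot> b\<close>.\<close>

definition kernels_distribute :: "('o, 'm) category_data \<Rightarrow> 'o \<Rightarrow> bool" where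
  "kernels_distribute C X \<longleftrightarrow>
     (\<forall>r s t T a b. regular_epi C r \<and> regular_epi C s \<and> regular_epi C t \<and>
        Dom C r = X \<and> Dom C s = X \<and> Dom C t = X \<and> a \<in> Hom C T X \<and> b \<in> Hom C T X \<and>
        r \<odot>\<^bsub>C\<^esub> a = r \<odot>\<^bsub>C\<^esub> b \<and> kernel_composite C s t a b \<longrightarrow>
        (\<exists>e w. regular_epi C e \<and> Cod C e = T \<and> w \<in> Hom C (Dom C e) X \<and>
           r \<odot>\<^bsub>C\<^esub> w = r \<odot>\<^bsub>C\<^esub> (a \<odot>\<^bsub>C\<^esub> e) \<and> s \<odot>\<^bsub>C\<^esub> w = s \<odot>\<^bsub>C\<^esub> (a \<odot>\<^bsub>C\<^esub> e) \<and>
           t \<odot>\<^bsub>C\<^esub> w = t \<odot>\<^bsub>C\<^esub> (b \<odot>\<^bsub>C\<^esub> e)))"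

context category
begin

lemma subobject_le_iff_extent:
  assumes "is_relation C X P p q m" "is_relation C X P p q m'"
  shows "subobject_le C m m' \<longleftrightarrow> extent C X p q m \<subseteq> extent C X p q m'"
  unfolding subobject_le_iff_related[OF assms] extent_def by (auto simp del: Hom_iff)

end

section \<open>Meets and joins of equivalence relations, computed on elements\<close>

locale exact_maltsev_category = exact_category + maltsev_category
begin

lemma equivalence_relation_kernel_extent:
  assumes m: "m \<in> carrier (Equiv C X P p q)"
  obtains f where "regular_epi C f" "Dom C f = X" "extent C X p q m = kernel_extent C f"
proof -
  have eq: "is_equivalence_relation C X P p q m" using m by (simp add: Equiv_def)
  then have R: "is_relation C X P p q m" by (simp add: is_equivalence_relation_def)
  obtain f where f: "regular_epi C f" "Dom C f = X"
    and rel: "\<And>T a b. a \<in> Hom C T X \<Longrightarrow> b \<in> Hom C T X \<Longrightarrow> related C p q m a b \<longleftrightarrow> f \<odot> a = f \<odot> b"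
    using equivalence_relation_regular_kernel[OF R equivalence_relation_effective[OF eq]] by blast
  have "extent C X p q m = kernel_extent C f"
    unfolding extent_def kernel_extent_def f(2) using rel by (auto simp del: Hom_iff)
  then show ?thesis using that f by blast
qed

lemma kernel_extent_exists:
  assumes "f \<in> Arr C" "Dom C f = X" "is_product C X X P p q"
  obtains m where "m \<in> carrier (Equiv C X P p q)" "extent C X p q m = kernel_extent C f"
proof -
  obtain m where m: "is_equivalence_relation C X P p q m"
    and rel: "\<And>T a b. a \<in> Hom C T X \<Longrightarrow> b \<in> Hom C T X \<Longrightarrow> related C p q m a b \<longleftrightarrow> f \<odot> a = f \<odot> b"
    using kernel_relation_exists[OF assms] by blast
  have "extent C X p q m = kernel_extent C f"
    unfolding extent_def kernel_extent_def assms(2) using rel by (auto simp del: Hom_iff)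
  then show ?thesis using that m by (simp add: Equiv_def)
qed

lemma Equiv_le_iff_extent:
  assumes "x \<in> carrier (Equiv C X P p q)" "y \<in> carrier (Equiv C X P p q)"
  shows "x \<sqsubseteq>\<^bsub>Equiv C X P p q\<^esub> y \<longleftrightarrow> extent C X p q x \<subseteq> extent C X p q y"
    "x .=\<^bsub>Equiv C X P p q\<^esub> y \<longleftrightarrow> extent C X p q x = extent C X p q y"
  using assms subobject_le_iff_extent[of X P p q] by (auto simp: Equiv_def is_equivalence_relation_def)

text \<open>In a Mal'tsev category the composite of two equivalence relations is reflexive, hence an
  equivalence relation, and so it is their join.\<close>

lemma join_extent_exists:
  assumes f: "f \<in> Arr C" "Dom C f = X" and g: "g \<in> Arr C" "Dom C g = X"
    and pr: "is_product C X X P p q"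
  obtains m where "m \<in> carrier (Equiv C X P p q)"
    "extent C X p q m =
       {(a, b). \<exists>T. a \<in> Hom C T X \<and> b \<in> Hom C T X \<and> kernel_composite C f g a b}"
proof -
  obtain m where R: "is_relation C X P p q m"
    and rel: "\<And>T a b. a \<in> Hom C T X \<Longrightarrow> b \<in> Hom C T X \<Longrightarrow>
       related C p q m a b \<longleftrightarrow> kernel_composite C f g a b"
    using composite_relation_exists[OF f g pr] by blast
  have X: "X \<in> Obj C" using f by auto
  have "kernel_composite C f g (Id C X) (Id C X)"
    unfolding kernel_composite_def using f g X
    by (intro exI[of _ "Id C X"]) (auto intro: regular_epi_Id)
  then have "related C p q m (Id C X) (Id C X)" using rel[of "Id C X" X "Id C X"] X by simp
  then have "is_reflexive C X p q m"
    using X by (auto simp: is_reflexive_def related_def simp del: Comp_assoc')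
  then have "m \<in> carrier (Equiv C X P p q)"
    using reflexive_relation_equivalence[OF R] by (simp add: Equiv_def)
  moreover have "extent C X p q m =
      {(a, b). \<exists>T. a \<in> Hom C T X \<and> b \<in> Hom C T X \<and> kernel_composite C f g a b}"
    unfolding extent_def using rel by (auto simp del: Hom_iff)
  ultimately show ?thesis using that by blast
qed

text \<open>The pairing of \<open>f\<close> and \<open>g\<close> into the product of their codomains
  identifies exactly what both of them identify.\<close>

lemma kernel_extent_Int:
  assumes f: "f \<in> Arr C" "Dom C f = X" and g: "g \<in> Arr C" "Dom C g = X"
  obtains k where "k \<in> Arr C" "Dom C k = X" "kernel_extent C k = kernel_extent C f \<inter> kernel_extent C g"
proof -
  obtain Q u v where pr: "is_product C (Cod C f) (Cod C g) Q u v" using product_exists f g by (metis Cod_Obj)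
  note D = productD[OF pr]
  obtain k where k: "k \<in> Hom C X Q" "u \<odot> k = f" "v \<odot> k = g"
    using product_lift[OF pr, of f g] f g by auto
  have "k \<odot> a = k \<odot> b \<longleftrightarrow> f \<odot> a = f \<odot> b \<and> g \<odot> a = g \<odot> b"
    if ab: "a \<in> Hom C T X" "b \<in> Hom C T X" for T a b
  proof -
    have eqs: "u \<odot> (k \<odot> a) = f \<odot> a" "u \<odot> (k \<odot> b) = f \<odot> b" "v \<odot> (k \<odot> a) = g \<odot> a" "v \<odot> (k \<odot> b) = g \<odot> b"
      using Comp_rewrite[OF k(2), of a] Comp_rewrite[OF k(2), of b]
        Comp_rewrite[OF k(3), of a] Comp_rewrite[OF k(3), of b] k(1) ab D by auto
    have "k \<odot> a = k \<odot> b" if "f \<odot> a = f \<odot> b \<and> g \<odot> a = g \<odot> b"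
      by (rule product_unique[OF pr]) (use that k(1) ab in \<open>auto simp: eqs\<close>)
    then show ?thesis using eqs by metis
  qed
  then have "kernel_extent C k = kernel_extent C f \<inter> kernel_extent C g"
    using k(1) f g unfolding kernel_extent_def by auto
  then show ?thesis using that k by auto
qed

lemma meet_extent_exists:
  assumes x: "x \<in> carrier (Equiv C X P p q)" and y: "y \<in> carrier (Equiv C X P p q)"
  obtains m where "m \<in> carrier (Equiv C X P p q)" "extent C X p q m = extent C X p q x \<inter> extent C X p q y"
proof -
  have pr: "is_product C X X P p q"
    using x by (simp add: Equiv_def is_equivalence_relation_def is_relation_def)
  obtain f where f: "regular_epi C f" "Dom C f = X" "extent C X p q x = kernel_extent C f"
    using equivalence_relation_kernel_extent[OF x] by blast
  obtain g where g: "regular_epi C g" "Dom C g = X" "extent C X p q y = kernel_extent C g"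
    using equivalence_relation_kernel_extent[OF y] by blast
  obtain k where k: "k \<in> Arr C" "Dom C k = X" "kernel_extent C k = kernel_extent C f \<inter> kernel_extent C g"
    using kernel_extent_Int[of f X g] f g by auto
  then show ?thesis using that kernel_extent_exists[OF k(1,2) pr] f g by metis
qed

text \<open>The reason why the composite is least among the upper bounds: \<open>k\<close>
  identifies both ends with the local intermediate element, and the cover on which that element
  lives is epic.\<close>

lemma kernel_extent_mono_composite:
  assumes k: "k \<in> Arr C" "Dom C k = X" and f: "f \<in> Arr C" "Dom C f = X" and g: "g \<in> Arr C" "Dom C g = X"
    and sub: "kernel_extent C f \<subseteq> kernel_extent C k" "kernel_extent C g \<subseteq> kernel_extent C k"
    and ab: "a \<in> Hom C T X" "b \<in> Hom C T X" "kernel_composite C f g a b"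
  shows "k \<odot> a = k \<odot> b"
proof -
  obtain e z where e: "regular_epi C e" "Cod C e = T" "z \<in> Hom C (Dom C e) X"
    "f \<odot> (a \<odot> e) = f \<odot> z" "g \<odot> z = g \<odot> (b \<odot> e)"
    using ab f unfolding kernel_composite_def by auto
  have eA: "e \<in> Arr C" using e by simp
  have "(a \<odot> e, z) \<in> kernel_extent C f" "(z, b \<odot> e) \<in> kernel_extent C g"
    using e ab eA f g by (auto simp: kernel_extent_def)
  then have "(a \<odot> e, z) \<in> kernel_extent C k" "(z, b \<odot> e) \<in> kernel_extent C k"
    using sub by blast+
  then have "k \<odot> (a \<odot> e) = k \<odot> z" "k \<odot> z = k \<odot> (b \<odot> e)"
    unfolding kernel_extent_def by blast+
  then have "k \<odot> (a \<odot> e) = k \<odot> (b \<odot> e)" by simp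
  then have "(k \<odot> a) \<odot> e = (k \<odot> b) \<odot> e" using k ab(1,2) e(2) eA by simp
  then show ?thesis by (rule regular_epi_cancel[OF e(1)]) (use k ab(1,2) e(2) in auto)
qed

lemma kernel_extent_le_composite:
  assumes f: "f \<in> Arr C" and g: "g \<in> Arr C" "Dom C g = Dom C f"
    and ab: "a \<in> Hom C T (Dom C f)" "b \<in> Hom C T (Dom C f)" and eq: "f \<odot> a = f \<odot> b \<or> g \<odot> a = g \<odot> b"
  shows "kernel_composite C f g a b"
proof -
  have T: "T \<in> Obj C" using ab by auto
  show ?thesis
    unfolding kernel_composite_def
    by (intro exI[of _ "Id C T"] exI[of _ "if f \<odot> a = f \<odot> b then b else a"])
      (use eq ab T regular_epi_Id[OF T] in auto)
qed

lemma least_Upper_extent: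
  assumes x: "x \<in> carrier (Equiv C X P p q)" and y: "y \<in> carrier (Equiv C X P p q)"
    and f: "regular_epi C f" "Dom C f = X" "extent C X p q x = kernel_extent C f"
    and g: "regular_epi C g" "Dom C g = X" "extent C X p q y = kernel_extent C g"
    and j: "j \<in> carrier (Equiv C X P p q)"
      "extent C X p q j =
         {(a, b). \<exists>T. a \<in> Hom C T X \<and> b \<in> Hom C T X \<and> kernel_composite C f g a b}"
  shows "least (Equiv C X P p q) j (Upper (Equiv C X P p q) {x, y})"
proof -
  have A: "f \<in> Arr C" "g \<in> Arr C" using f g by auto
  have "kernel_extent C f \<subseteq> extent C X p q j" "kernel_extent C g \<subseteq> extent C X p q j"
    unfolding j(2) kernel_extent_def f(2) g(2)
    using kernel_extent_le_composite[of f g] A f(2) g(2) by (auto simp del: Hom_iff)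
  then have up: "x \<sqsubseteq>\<^bsub>Equiv C X P p q\<^esub> j" "y \<sqsubseteq>\<^bsub>Equiv C X P p q\<^esub> j"
    using f g j x y by (simp_all add: Equiv_le_iff_extent(1))
  have "j \<sqsubseteq>\<^bsub>Equiv C X P p q\<^esub> z"
    if z: "z \<in> carrier (Equiv C X P p q)" "x \<sqsubseteq>\<^bsub>Equiv C X P p q\<^esub> z" "y \<sqsubseteq>\<^bsub>Equiv C X P p q\<^esub> z" for z
  proof -
    obtain k where k: "regular_epi C k" "Dom C k = X" "extent C X p q z = kernel_extent C k"
      using equivalence_relation_kernel_extent[OF z(1)] by blast
    have sub: "kernel_extent C f \<subseteq> kernel_extent C k" "kernel_extent C g \<subseteq> kernel_extent C k"
      using z x y f g k by (simp_all add: Equiv_le_iff_extent(1))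
    have "extent C X p q j \<subseteq> kernel_extent C k"
    proof (rule subrelI)
      fix a b assume "(a, b) \<in> extent C X p q j"
      then obtain T where ab: "a \<in> Hom C T X" "b \<in> Hom C T X" "kernel_composite C f g a b"
        unfolding j(2) by blast
      have "k \<odot> a = k \<odot> b"
        by (rule kernel_extent_mono_composite[OF _ k(2) A(1) f(2) A(2) g(2) sub ab]) (use k in simp)
      then show "(a, b) \<in> kernel_extent C k"
        unfolding kernel_extent_def k(2) using ab by blast
    qed
    then show ?thesis using k j z by (simp add: Equiv_le_iff_extent(1))
  qed
  then show ?thesis using up j(1) x y by (auto simp: least_def Upper_def)
qed

text \<open>Through \<open>extent\<close> the axioms of a partial order are those of set inclusion;
  only the existence of joins and meets has content.\<close>

lemma weak_lattice_Equiv: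
  assumes pr: "is_product C X X P p q"
  shows "weak_lattice (Equiv C X P p q)"
proof
  let ?L = "Equiv C X P p q"
  note le = Equiv_le_iff_extent[of _ X P p q]
  show "x .=\<^bsub>?L\<^esub> x" if "x \<in> carrier ?L" for x using that le by simp
  show "y .=\<^bsub>?L\<^esub> x" if "x .=\<^bsub>?L\<^esub> y" "x \<in> carrier ?L" "y \<in> carrier ?L" for x y
    using that le by simp
  show "x .=\<^bsub>?L\<^esub> z" if "x .=\<^bsub>?L\<^esub> y" "y .=\<^bsub>?L\<^esub> z" "x \<in> carrier ?L" "y \<in> carrier ?L" "z \<in> carrier ?L" for x y z
    using that le by simp
  show "x \<sqsubseteq>\<^bsub>?L\<^esub> x" if "x \<in> carrier ?L" for x using that le by simp
  show "x .=\<^bsub>?L\<^esub> y" if "x \<sqsubseteq>\<^bsub>?L\<^esub> y" "y \<sqsubseteq>\<^bsub>?L\<^esub> x" "x \<in> carrier ?L" "y \<in> carrier ?L" for x y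
    using that le by auto
  show "x \<sqsubseteq>\<^bsub>?L\<^esub> z" if "x \<sqsubseteq>\<^bsub>?L\<^esub> y" "y \<sqsubseteq>\<^bsub>?L\<^esub> z" "x \<in> carrier ?L" "y \<in> carrier ?L" "z \<in> carrier ?L" for x y z
    using that le by auto
  show "x \<sqsubseteq>\<^bsub>?L\<^esub> z \<longleftrightarrow> y \<sqsubseteq>\<^bsub>?L\<^esub> w" if "x .=\<^bsub>?L\<^esub> y" "z .=\<^bsub>?L\<^esub> w" "x \<in> carrier ?L" "y \<in> carrier ?L"
    "z \<in> carrier ?L" "w \<in> carrier ?L" for x y z w
    using that le by simp
  fix x y assume xy: "x \<in> carrier ?L" "y \<in> carrier ?L"
  obtain f where f: "regular_epi C f" "Dom C f = X" "extent C X p q x = kernel_extent C f"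
    using equivalence_relation_kernel_extent[OF xy(1)] by blast
  obtain g where g: "regular_epi C g" "Dom C g = X" "extent C X p q y = kernel_extent C g"
    using equivalence_relation_kernel_extent[OF xy(2)] by blast
  obtain j where j: "j \<in> carrier ?L" "extent C X p q j =
         {(a, b). \<exists>T. a \<in> Hom C T X \<and> b \<in> Hom C T X \<and> kernel_composite C f g a b}"
    by (rule join_extent_exists[OF regular_epi_Arr[OF f(1)] f(2) regular_epi_Arr[OF g(1)] g(2) pr])
  show "\<exists>s. least ?L s (Upper ?L {x, y})"
    using least_Upper_extent[OF xy f g j] by blast
  obtain m where m: "m \<in> carrier ?L" "extent C X p q m = extent C X p q x \<inter> extent C X p q y"
    using meet_extent_exists[OF xy] by blast
  have lower: "Lower ?L {x, y} = {l \<in> carrier ?L. l \<sqsubseteq>\<^bsub>?L\<^esub> x \<and> l \<sqsubseteq>\<^bsub>?L\<^esub> y}"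
    using xy by (auto simp: Lower_def)
  have "l \<sqsubseteq>\<^bsub>?L\<^esub> m" if "l \<in> carrier ?L" "l \<sqsubseteq>\<^bsub>?L\<^esub> x" "l \<sqsubseteq>\<^bsub>?L\<^esub> y" for l
    using that m xy le(1) by (metis Int_greatest)
  moreover have "m \<sqsubseteq>\<^bsub>?L\<^esub> x" "m \<sqsubseteq>\<^bsub>?L\<^esub> y" using m xy le(1) by (metis Int_lower1 Int_lower2)+
  ultimately have "greatest ?L m (Lower ?L {x, y})"
    using m(1) unfolding greatest_def lower by blast
  then show "\<exists>s. greatest ?L s (Lower ?L {x, y})" by blast
qed

text \<open>The join of the lattice is an arbitrary choice among least upper bounds. All of them are
  equivalent to the composite, and equivalent relations have equal extents.\<close>

lemma join_extent:
  assumes x: "x \<in> carrier (Equiv C X P p q)" and y: "y \<in> carrier (Equiv C X P p q)"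
    and f: "regular_epi C f" "Dom C f = X" "extent C X p q x = kernel_extent C f"
    and g: "regular_epi C g" "Dom C g = X" "extent C X p q y = kernel_extent C g"
  shows "extent C X p q (x \<squnion>\<^bsub>Equiv C X P p q\<^esub> y) =
    {(a, b). \<exists>T. a \<in> Hom C T X \<and> b \<in> Hom C T X \<and> kernel_composite C f g a b}"
proof -
  let ?L = "Equiv C X P p q"
  have pr: "is_product C X X P p q"
    using x by (simp add: Equiv_def is_equivalence_relation_def is_relation_def)
  interpret L: weak_lattice ?L by (rule weak_lattice_Equiv[OF pr])
  obtain j where j: "j \<in> carrier ?L" "extent C X p q j =
         {(a, b). \<exists>T. a \<in> Hom C T X \<and> b \<in> Hom C T X \<and> kernel_composite C f g a b}"
    by (rule join_extent_exists[OF regular_epi_Arr[OF f(1)] f(2) regular_epi_Arr[OF g(1)] g(2) pr])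
  have "x \<squnion>\<^bsub>?L\<^esub> y .=\<^bsub>?L\<^esub> j"
    using L.weak_least_unique[OF _ least_Upper_extent[OF x y f g j]] L.sup_of_two_least[OF x y]
    by (simp add: join_def)
  then show ?thesis using Equiv_le_iff_extent(2) L.join_closed[OF x y] j by metis
qed

lemma meet_extent:
  assumes x: "x \<in> carrier (Equiv C X P p q)" and y: "y \<in> carrier (Equiv C X P p q)"
  shows "extent C X p q (x \<sqinter>\<^bsub>Equiv C X P p q\<^esub> y) = extent C X p q x \<inter> extent C X p q y"
proof -
  let ?L = "Equiv C X P p q"
  have pr: "is_product C X X P p q"
    using x by (simp add: Equiv_def is_equivalence_relation_def is_relation_def)
  interpret L: weak_lattice ?L by (rule weak_lattice_Equiv[OF pr])
  obtain m where m: "m \<in> carrier ?L" "extent C X p q m = extent C X p q x \<inter> extent C X p q y"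
    using meet_extent_exists[OF x y] by blast
  have mc: "x \<sqinter>\<^bsub>?L\<^esub> y \<in> carrier ?L" using L.meet_closed[OF x y] .
  note le = Equiv_le_iff_extent(1)[of _ X P p q]
  have "x \<sqinter>\<^bsub>?L\<^esub> y \<sqsubseteq>\<^bsub>?L\<^esub> x" "x \<sqinter>\<^bsub>?L\<^esub> y \<sqsubseteq>\<^bsub>?L\<^esub> y" "m \<sqsubseteq>\<^bsub>?L\<^esub> x \<sqinter>\<^bsub>?L\<^esub> y"
    using L.meet_left[OF x y] L.meet_right[OF x y] L.meet_le[of m x y] m x y le by auto
  then show ?thesis using le mc m x y by auto
qed

lemma kernels_distribute_if_distributive:
  assumes pr: "is_product C X X P p q" and dist: "weak_distributive_lattice (Equiv C X P p q)"
  shows "kernels_distribute C X"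
  unfolding kernels_distribute_def
proof (intro allI impI, elim conjE)
  fix r s t T a b
  assume reg: "regular_epi C r" "regular_epi C s" "regular_epi C t"
    and dom: "Dom C r = X" "Dom C s = X" "Dom C t = X"
    and ab: "a \<in> Hom C T X" "b \<in> Hom C T X" and eq: "r \<odot> a = r \<odot> b" and comp: "kernel_composite C s t a b"
  let ?L = "Equiv C X P p q" and ?E = "extent C X p q"
  interpret L: weak_distributive_lattice ?L by (rule dist)
  have A: "r \<in> Arr C" "s \<in> Arr C" "t \<in> Arr C" using reg by auto
  obtain x where x: "x \<in> carrier ?L" "?E x = kernel_extent C r"
    using kernel_extent_exists[OF A(1) dom(1) pr] by blast
  obtain y where y: "y \<in> carrier ?L" "?E y = kernel_extent C s"
    using kernel_extent_exists[OF A(2) dom(2) pr] by blast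
  obtain z where z: "z \<in> carrier ?L" "?E z = kernel_extent C t"
    using kernel_extent_exists[OF A(3) dom(3) pr] by blast
  have "(a, b) \<in> ?E x" unfolding x(2) kernel_extent_def dom using ab eq by blast
  moreover have "(a, b) \<in> ?E (y \<squnion>\<^bsub>?L\<^esub> z)"
    unfolding join_extent[OF y(1) z(1) reg(2) dom(2) y(2) reg(3) dom(3) z(2)]
    using ab comp by auto
  ultimately have "(a, b) \<in> ?E (x \<sqinter>\<^bsub>?L\<^esub> (y \<squnion>\<^bsub>?L\<^esub> z))"
    using meet_extent[of x X P p q] x y z by simp
  moreover have "x \<sqinter>\<^bsub>?L\<^esub> (y \<squnion>\<^bsub>?L\<^esub> z) .=\<^bsub>?L\<^esub> (x \<sqinter>\<^bsub>?L\<^esub> y) \<squnion>\<^bsub>?L\<^esub> (x \<sqinter>\<^bsub>?L\<^esub> z)"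
    using L.meet_join_distrib x y z by blast
  ultimately have mem: "(a, b) \<in> ?E ((x \<sqinter>\<^bsub>?L\<^esub> y) \<squnion>\<^bsub>?L\<^esub> (x \<sqinter>\<^bsub>?L\<^esub> z))"
    using Equiv_le_iff_extent(2)[of "x \<sqinter>\<^bsub>?L\<^esub> (y \<squnion>\<^bsub>?L\<^esub> z)" X P p q] x y z by auto
  have c: "x \<sqinter>\<^bsub>?L\<^esub> y \<in> carrier ?L" "x \<sqinter>\<^bsub>?L\<^esub> z \<in> carrier ?L" using x y z by auto
  \<comment> \<open>Presented as kernels of quotient maps of their own, the two meets have a join
    that is again a composite; its local intermediate element is the required
    \<open>w\<close>.\<close>
  obtain f where f: "regular_epi C f" "Dom C f = X" "?E (x \<sqinter>\<^bsub>?L\<^esub> y) = kernel_extent C f"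
    using equivalence_relation_kernel_extent[OF c(1)] by blast
  obtain g where g: "regular_epi C g" "Dom C g = X" "?E (x \<sqinter>\<^bsub>?L\<^esub> z) = kernel_extent C g"
    using equivalence_relation_kernel_extent[OF c(2)] by blast
  have "kernel_composite C f g a b"
    using mem unfolding join_extent[OF c f g] by auto
  then obtain e w where e: "regular_epi C e" "Cod C e = T" "w \<in> Hom C (Dom C e) X"
    "f \<odot> (a \<odot> e) = f \<odot> w" "g \<odot> w = g \<odot> (b \<odot> e)"
    using ab f unfolding kernel_composite_def by auto
  have eA: "e \<in> Arr C" using e by simp
  have "(a \<odot> e, w) \<in> kernel_extent C f" "(w, b \<odot> e) \<in> kernel_extent C g"
    using e ab eA f g by (auto simp: kernel_extent_def)
  then have "(a \<odot> e, w) \<in> kernel_extent C r \<inter> kernel_extent C s" "(w, b \<odot> e) \<in> kernel_extent C t"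
    using f(3) g(3) meet_extent[OF x(1) y(1)] meet_extent[OF x(1) z(1)] x y z by auto
  then have "r \<odot> w = r \<odot> (a \<odot> e)" "s \<odot> w = s \<odot> (a \<odot> e)" "t \<odot> w = t \<odot> (b \<odot> e)"
    by (auto simp: kernel_extent_def)
  then show "\<exists>e w. regular_epi C e \<and> Cod C e = T \<and> w \<in> Hom C (Dom C e) X \<and>
      r \<odot> w = r \<odot> (a \<odot> e) \<and> s \<odot> w = s \<odot> (a \<odot> e) \<and> t \<odot> w = t \<odot> (b \<odot> e)"
    using e by blast
qed

lemma distributive_if_kernels_distribute:
  assumes pr: "is_product C X X P p q" and kd: "kernels_distribute C X"
  shows "weak_distributive_lattice (Equiv C X P p q)"
proof -
  let ?L = "Equiv C X P p q" and ?E = "extent C X p q"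
  interpret L: weak_lattice ?L by (rule weak_lattice_Equiv[OF pr])
  show ?thesis
  proof
    fix x y z assume xyz: "x \<in> carrier ?L" "y \<in> carrier ?L" "z \<in> carrier ?L"
    have c: "x \<sqinter>\<^bsub>?L\<^esub> y \<in> carrier ?L" "x \<sqinter>\<^bsub>?L\<^esub> z \<in> carrier ?L" "y \<squnion>\<^bsub>?L\<^esub> z \<in> carrier ?L" using xyz by auto
    obtain r where r: "regular_epi C r" "Dom C r = X" "?E x = kernel_extent C r"
      using equivalence_relation_kernel_extent[OF xyz(1)] by blast
    obtain s where s: "regular_epi C s" "Dom C s = X" "?E y = kernel_extent C s"
      using equivalence_relation_kernel_extent[OF xyz(2)] by blast
    obtain t where t: "regular_epi C t" "Dom C t = X" "?E z = kernel_extent C t"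
      using equivalence_relation_kernel_extent[OF xyz(3)] by blast
    obtain f where f: "regular_epi C f" "Dom C f = X" "?E (x \<sqinter>\<^bsub>?L\<^esub> y) = kernel_extent C f"
      using equivalence_relation_kernel_extent[OF c(1)] by blast
    obtain g where g: "regular_epi C g" "Dom C g = X" "?E (x \<sqinter>\<^bsub>?L\<^esub> z) = kernel_extent C g"
      using equivalence_relation_kernel_extent[OF c(2)] by blast
    have "?E x \<inter> ?E (y \<squnion>\<^bsub>?L\<^esub> z) \<subseteq> ?E ((x \<sqinter>\<^bsub>?L\<^esub> y) \<squnion>\<^bsub>?L\<^esub> (x \<sqinter>\<^bsub>?L\<^esub> z))"
    proof (rule subrelI)
      fix a b assume "(a, b) \<in> ?E x \<inter> ?E (y \<squnion>\<^bsub>?L\<^esub> z)"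
      then have "(a, b) \<in> kernel_extent C r"
        and *: "(a, b) \<in> {(a, b). \<exists>T. a \<in> Hom C T X \<and> b \<in> Hom C T X \<and> kernel_composite C s t a b}"
        unfolding r(3) join_extent[OF xyz(2,3) s t] by auto
      then obtain T where ab: "a \<in> Hom C T X" "b \<in> Hom C T X" "r \<odot> a = r \<odot> b" "kernel_composite C s t a b"
        using r by (auto simp: kernel_extent_def)
      then obtain e w where e: "regular_epi C e" "Cod C e = T" "w \<in> Hom C (Dom C e) X"
        and w: "r \<odot> w = r \<odot> (a \<odot> e)" "s \<odot> w = s \<odot> (a \<odot> e)" "t \<odot> w = t \<odot> (b \<odot> e)"
        using kd r s t unfolding kernels_distribute_def by metis
      have eA: "e \<in> Arr C" using e by simp
      \<comment> \<open>The point \<open>w\<close> is tied to \<open>a\<close> under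
        \<open>r\<close>; moving along \<open>r \<odot> a = r \<odot> b\<close> ties it to
        \<open>b\<close> as well, which puts the second link into the second meet.\<close>
      have "r \<odot> (a \<odot> e) = r \<odot> (b \<odot> e)"
        by (rule Comp_cong_right[OF ab(3)]) (use ab(1,2) r(1,2) eA e(2) in auto)
      then have "r \<odot> w = r \<odot> (b \<odot> e)" using w by simp
      then have "(a \<odot> e, w) \<in> ?E x \<inter> ?E y" "(w, b \<odot> e) \<in> ?E x \<inter> ?E z"
        unfolding r(3) s(3) t(3) kernel_extent_def
        using w e ab(1,2) r(2) s(2) t(2) eA by auto
      then have "(a \<odot> e, w) \<in> kernel_extent C f" "(w, b \<odot> e) \<in> kernel_extent C g"
        using meet_extent xyz f(3) g(3) by auto
      then have "f \<odot> (a \<odot> e) = f \<odot> w" "g \<odot> w = g \<odot> (b \<odot> e)" by (auto simp: kernel_extent_def)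
      then have "kernel_composite C f g a b"
        unfolding kernel_composite_def using e ab f by auto
      then show "(a, b) \<in> ?E ((x \<sqinter>\<^bsub>?L\<^esub> y) \<squnion>\<^bsub>?L\<^esub> (x \<sqinter>\<^bsub>?L\<^esub> z))"
        unfolding join_extent[OF c(1,2) f g] using ab by auto
    qed
    then have 1: "x \<sqinter>\<^bsub>?L\<^esub> (y \<squnion>\<^bsub>?L\<^esub> z) \<sqsubseteq>\<^bsub>?L\<^esub> (x \<sqinter>\<^bsub>?L\<^esub> y) \<squnion>\<^bsub>?L\<^esub> (x \<sqinter>\<^bsub>?L\<^esub> z)"
      using xyz c meet_extent[OF xyz(1) c(3)] by (subst Equiv_le_iff_extent(1)) auto
    \<comment> \<open>The reverse inequality holds in every lattice.\<close>
    have "x \<sqinter>\<^bsub>?L\<^esub> y \<sqsubseteq>\<^bsub>?L\<^esub> y \<squnion>\<^bsub>?L\<^esub> z" "x \<sqinter>\<^bsub>?L\<^esub> z \<sqsubseteq>\<^bsub>?L\<^esub> y \<squnion>\<^bsub>?L\<^esub> z"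
      using xyz c L.meet_right L.join_left L.join_right L.le_trans by meson+
    then have 2: "(x \<sqinter>\<^bsub>?L\<^esub> y) \<squnion>\<^bsub>?L\<^esub> (x \<sqinter>\<^bsub>?L\<^esub> z) \<sqsubseteq>\<^bsub>?L\<^esub> x \<sqinter>\<^bsub>?L\<^esub> (y \<squnion>\<^bsub>?L\<^esub> z)"
      using xyz c by (intro L.join_le L.meet_le L.meet_left) auto
    show "x \<sqinter>\<^bsub>?L\<^esub> (y \<squnion>\<^bsub>?L\<^esub> z) .=\<^bsub>?L\<^esub> (x \<sqinter>\<^bsub>?L\<^esub> y) \<squnion>\<^bsub>?L\<^esub> (x \<sqinter>\<^bsub>?L\<^esub> z)"
      using 1 2 xyz c by (intro L.weak_le_antisym) auto
  qed
qed

end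

section \<open>From pairwise pushouts to arithmetical categories\<close>

definition pairwise_condition :: "('o, 'm) category_data \<Rightarrow> nat \<Rightarrow> bool" where
  "pairwise_condition C n \<longleftrightarrow>
    (\<forall>X B r. (\<forall>i. 1 \<le> i \<and> i \<le> n \<longrightarrow> r i \<in> Hom C X (B i) \<and> regular_epi C (r i)) \<longrightarrow>
       (\<forall>i j. 1 \<le> i \<and> i < j \<and> j \<le> n \<longrightarrow> (\<exists>p q. is_pushout C (r i) (r j) p q)) \<and>
       (\<forall>D p q L l.
          (\<forall>i j. 1 \<le> i \<and> i < j \<and> j \<le> n \<longrightarrow>
             p i j \<in> Hom C (B i) (D i j) \<and> q i j \<in> Hom C (B j) (D i j) \<and>
             is_pushout C (r i) (r j) (p i j) (q i j)) \<and>
          is_limit C (pairwise_diagram n B D p q) L l \<longrightarrow>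
          regular_epi C
            (comparison C (pairwise_diagram n B D p q) L l X (pairwise_cone C r p))))"

lemma pairwise_condition_pushout:
  assumes "pairwise_condition C n" "\<And>i. r i \<in> Hom C X (B i) \<and> regular_epi C (r i)"
    and "1 \<le> i" "i < j" "j \<le> n"
  shows "\<exists>p q. is_pushout C (r i) (r j) p q"
proof -
  have "\<forall>i. 1 \<le> i \<and> i \<le> n \<longrightarrow> r i \<in> Hom C X (B i) \<and> regular_epi C (r i)" using assms(2) by blast
  then show ?thesis using assms(1)[unfolded pairwise_condition_def] assms(3-5) by meson
qed

lemma pairwise_condition_comparison:
  assumes "pairwise_condition C n" "\<And>i. r i \<in> Hom C X (B i) \<and> regular_epi C (r i)"
    and "\<forall>i j. 1 \<le> i \<and> i < j \<and> j \<le> n \<longrightarrow> p i j \<in> Hom C (B i) (D i j) \<and> q i j \<in> Hom C (B j) (D i j)"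
    and "\<And>i j. 1 \<le> i \<Longrightarrow> i < j \<Longrightarrow> j \<le> n \<Longrightarrow> is_pushout C (r i) (r j) (p i j) (q i j)"
    and "is_limit C (pairwise_diagram n B D p q) L l"
  shows "regular_epi C (comparison C (pairwise_diagram n B D p q) L l X (pairwise_cone C r p))"
proof -
  have 1: "\<forall>i. 1 \<le> i \<and> i \<le> n \<longrightarrow> r i \<in> Hom C X (B i) \<and> regular_epi C (r i)" using assms(2) by blast
  have 2: "(\<forall>i j. 1 \<le> i \<and> i < j \<and> j \<le> n \<longrightarrow>
       p i j \<in> Hom C (B i) (D i j) \<and> q i j \<in> Hom C (B j) (D i j) \<and>
       is_pushout C (r i) (r j) (p i j) (q i j)) \<and>
     is_limit C (pairwise_diagram n B D p q) L l"
    using assms(3-5) by blast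
  show ?thesis using assms(1)[unfolded pairwise_condition_def] 1 2 by blast
qed

section \<open>The limit of the pairwise diagram as object of compatible families\<close>

lemma finite_pairwise_diagram:
  "finite (Nodes (pairwise_diagram n B D p q))" "finite (Edges (pairwise_diagram n B D p q))"
proof -
  have 1: "Nodes (pairwise_diagram n B D p q) \<subseteq> Base ` {..n} \<union> case_prod Apex ` ({..n} \<times> {..n})"
    by (auto simp: pairwise_diagram_def)
  have 2: "Edges (pairwise_diagram n B D p q) \<subseteq>
      case_prod LeftLeg ` ({..n} \<times> {..n}) \<union> case_prod RightLeg ` ({..n} \<times> {..n})"
    by (auto simp: pairwise_diagram_def)
  show "finite (Nodes (pairwise_diagram n B D p q))" by (rule finite_subset[OF 1]) simp
  show "finite (Edges (pairwise_diagram n B D p q))" by (rule finite_subset[OF 2]) simp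
qed

context category
begin

lemma comparison_mediates:
  assumes "is_limit C G L l" "is_cone C G X c"
  shows "mediates C G L l X c (comparison C G L l X c)"
  using assms unfolding is_limit_def comparison_def by (metis (no_types, lifting) theI')

lemma limit_unique:
  assumes "is_limit C G L l" "is_cone C G X c" "mediates C G L l X c h" "mediates C G L l X c k"
  shows "h = k"
  using assms unfolding is_limit_def by blast

lemma is_diagram_pairwise:
  assumes "\<And>i. 1 \<le> i \<Longrightarrow> i \<le> n \<Longrightarrow> B i \<in> Obj C"
    and "\<forall>i j. 1 \<le> i \<and> i < j \<and> j \<le> n \<longrightarrow> p i j \<in> Hom C (B i) (D i j) \<and> q i j \<in> Hom C (B j) (D i j)"
  shows "is_diagram C (pairwise_diagram n B D p q)"
proof -
  have "D i j \<in> Obj C" if "1 \<le> i" "i < j" "j \<le> n" for i j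
    using assms(2) that by (metis Hom_iff Obj_simps(2))
  then show ?thesis using assms unfolding is_diagram_def pairwise_diagram_def by auto
qed

text \<open>The components at the apexes are determined by those at the bases, so a cone amounts to
  a family on the bases that agrees in every pushout: the data of a remainder problem.\<close>

lemma is_cone_pairwise_iff:
  assumes "\<forall>i j. 1 \<le> i \<and> i < j \<and> j \<le> n \<longrightarrow> p i j \<in> Hom C (B i) (D i j) \<and> q i j \<in> Hom C (B j) (D i j)"
  shows "is_cone C (pairwise_diagram n B D p q) X c \<longleftrightarrow>
    X \<in> Obj C \<and> (\<forall>i. 1 \<le> i \<and> i \<le> n \<longrightarrow> c (Base i) \<in> Hom C X (B i)) \<and>
    (\<forall>i j. 1 \<le> i \<and> i < j \<and> j \<le> n \<longrightarrow> c (Apex i j) = p i j \<odot> c (Base i)) \<and>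
    (\<forall>i j. 1 \<le> i \<and> i < j \<and> j \<le> n \<longrightarrow> p i j \<odot> c (Base i) = q i j \<odot> c (Base j))" (is "?L \<longleftrightarrow> ?R")
proof
  assume L: ?L
  have b: "c (Base i) \<in> Hom C X (B i)" if "1 \<le> i" "i \<le> n" for i
    using L that unfolding is_cone_def pairwise_diagram_def by auto
  have e: "p i j \<odot> c (Base i) = c (Apex i j)" "q i j \<odot> c (Base j) = c (Apex i j)"
    if "1 \<le> i" "i < j" "j \<le> n" for i j
  proof -
    have "LeftLeg i j \<in> Edges (pairwise_diagram n B D p q)" "RightLeg i j \<in> Edges (pairwise_diagram n B D p q)"
      using that by (auto simp: pairwise_diagram_def)
    then have "ArrAt (pairwise_diagram n B D p q) (LeftLeg i j) \<odot> c (Src (pairwise_diagram n B D p q) (LeftLeg i j))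
        = c (Tgt (pairwise_diagram n B D p q) (LeftLeg i j))"
      "ArrAt (pairwise_diagram n B D p q) (RightLeg i j) \<odot> c (Src (pairwise_diagram n B D p q) (RightLeg i j))
        = c (Tgt (pairwise_diagram n B D p q) (RightLeg i j))"
      using L unfolding is_cone_def by blast+
    then show "p i j \<odot> c (Base i) = c (Apex i j)" "q i j \<odot> c (Base j) = c (Apex i j)"
      by (simp_all add: pairwise_diagram_def)
  qed
  have "X \<in> Obj C" using L by (simp add: is_cone_def)
  then show ?R using b e by (simp del: Hom_iff)
next
  assume R: ?R
  have a: "c (Apex i j) \<in> Hom C X (D i j)" if "1 \<le> i" "i < j" "j \<le> n" for i j
  proof -
    have "p i j \<odot> c (Base i) \<in> Hom C X (D i j)" using assms R that by simp
    then show ?thesis using R that by metis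
  qed
  show ?L
    unfolding is_cone_def
  proof (intro conjI ballI)
    show "X \<in> Obj C" using R by simp
    fix v assume "v \<in> Nodes (pairwise_diagram n B D p q)"
    then show "c v \<in> Hom C X (ObjAt (pairwise_diagram n B D p q) v)"
      using R a by (auto simp: pairwise_diagram_def simp del: Hom_iff)
  next
    fix e assume "e \<in> Edges (pairwise_diagram n B D p q)"
    then consider (l) i j where "e = LeftLeg i j" "1 \<le> i" "i < j" "j \<le> n"
      | (r) i j where "e = RightLeg i j" "1 \<le> i" "i < j" "j \<le> n"
      by (auto simp: pairwise_diagram_def)
    then show "ArrAt (pairwise_diagram n B D p q) e \<odot> c (Src (pairwise_diagram n B D p q) e) =
        c (Tgt (pairwise_diagram n B D p q) e)"
      by cases (use R in \<open>simp_all add: pairwise_diagram_def\<close>)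
  qed
qed

lemma mediates_pairwise_iff:
  assumes pq: "\<forall>i j. 1 \<le> i \<and> i < j \<and> j \<le> n \<longrightarrow> p i j \<in> Hom C (B i) (D i j) \<and> q i j \<in> Hom C (B j) (D i j)"
    and l: "is_cone C (pairwise_diagram n B D p q) L l" and c: "is_cone C (pairwise_diagram n B D p q) X c"
  shows "mediates C (pairwise_diagram n B D p q) L l X c h \<longleftrightarrow>
    h \<in> Hom C X L \<and> (\<forall>i. 1 \<le> i \<and> i \<le> n \<longrightarrow> l (Base i) \<odot> h = c (Base i))" (is "?M \<longleftrightarrow> ?R")
proof
  assume ?M
  then show ?R unfolding mediates_def by (auto simp: pairwise_diagram_def)
next
  assume R: ?R
  note l' = l[unfolded is_cone_pairwise_iff[of n p B D q, OF pq]] and c' = c[unfolded is_cone_pairwise_iff[of n p B D q, OF pq]]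
  have "l (Apex i j) \<odot> h = c (Apex i j)" if ij: "1 \<le> i" "i < j" "j \<le> n" for i j
  proof -
    have i: "i \<le> n" using ij by simp
    have "l (Apex i j) \<odot> h = (p i j \<odot> l (Base i)) \<odot> h" using l' ij by metis
    also have "\<dots> = p i j \<odot> (l (Base i) \<odot> h)"
      by (rule Comp_assoc') (use pq l' R ij i in auto)
    also have "\<dots> = c (Apex i j)" using R c' ij i by metis
    finally show ?thesis .
  qed
  then show ?M using R unfolding mediates_def by (auto simp: pairwise_diagram_def)
qed

lemma pushoutD:
  assumes "is_pushout C f g p q"
  shows "f \<in> Arr C" "g \<in> Arr C" "Dom C f = Dom C g" "p \<in> Arr C" "q \<in> Arr C" "Dom C p = Cod C f"
    "Dom C q = Cod C g" "Cod C q = Cod C p" "p \<odot> f = q \<odot> g"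
  using assms by (auto simp: is_pushout_def)

lemma pushout_regular_epi_self:
  assumes r: "regular_epi C r"
  shows "is_pushout C r r (Id C (Cod C r)) (Id C (Cod C r))"
  unfolding is_pushout_def
proof (intro conjI allI impI)
  have A: "r \<in> Arr C" using r by simp
  have Id: "Id C (Cod C r) \<in> Arr C" "Dom C (Id C (Cod C r)) = Cod C r" "Cod C (Id C (Cod C r)) = Cod C r"
    using A by auto
  fix Y a b
  assume ab: "a \<in> Hom C (Cod C r) Y \<and> b \<in> Hom C (Cod C r) Y \<and> a \<odot> r = b \<odot> r"
  then have "b = a" using regular_epi_cancel[OF r, of b a] by simp
  moreover have "h \<odot> Id C (Cod C r) = h" if "h \<in> Hom C (Cod C r) Y" for h
    using that by simp
  ultimately show "\<exists>!h. h \<in> Hom C (Cod C (Id C (Cod C r))) Y \<and> h \<odot> Id C (Cod C r) = a \<and> h \<odot> Id C (Cod C r) = b"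
    unfolding Id(3) using ab by metis
qed (use r in auto)

end

section \<open>Consequences of the pairwise condition\<close>

context regular_category
begin

lemma pushout_exists_if_pairwise_condition:
  assumes cond: "pairwise_condition C n" and n: "n \<ge> 3"
    and r: "regular_epi C r" "regular_epi C s" "Dom C r = Dom C s"
  obtains p q where "is_pushout C r s p q"
proof -
  let ?r = "\<lambda>i::nat. if i = 1 then r else s"
  have "?r i \<in> Hom C (Dom C r) (Cod C (?r i)) \<and> regular_epi C (?r i)" for i using r by auto
  then have "\<exists>p q. is_pushout C (?r 1) (?r 2) p q"
    by (intro pairwise_condition_pushout[OF cond, of ?r "Dom C r" "\<lambda>i. Cod C (?r i)"]) (use n in auto)
  then show ?thesis using that by auto
qed

text \<open>Apply the condition to the \<open>n\<close>-tuple in which the third morphism is repeated: the pushout of a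
  regular epimorphism with itself is trivial, so no further compatibility conditions arise.\<close>

lemma remainder_if_pairwise_condition:
  assumes cond: "pairwise_condition C n" and n: "n \<ge> 3"
    and r: "regular_epi C r1" "regular_epi C r2" "regular_epi C r3"
    and dom: "Dom C r1 = X" "Dom C r2 = X" "Dom C r3 = X"
    and po: "is_pushout C r1 r2 p12 q12" "is_pushout C r1 r3 p13 q13" "is_pushout C r2 r3 p23 q23"
    and b: "b1 \<in> Hom C T (Cod C r1)" "b2 \<in> Hom C T (Cod C r2)" "b3 \<in> Hom C T (Cod C r3)"
    and eq: "p12 \<odot> b1 = q12 \<odot> b2" "p13 \<odot> b1 = q13 \<odot> b3" "p23 \<odot> b2 = q23 \<odot> b3"
  obtains e x where "regular_epi C e" "Cod C e = T" "x \<in> Hom C (Dom C e) X"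
    "r1 \<odot> x = b1 \<odot> e" "r2 \<odot> x = b2 \<odot> e" "r3 \<odot> x = b3 \<odot> e"
proof -
  define sel where "sel = (\<lambda>(u::'b) v w i. if i = (1::nat) then u else if i = 2 then v else w)"
  define r where "r = sel r1 r2 r3"
  define b where "b = sel b1 b2 b3"
  define B where "B = (\<lambda>i. Cod C (r i))"
  \<comment> \<open>For \<open>1 \<le> i < j\<close>, a pair with \<open>i \<ge> 3\<close> consists
    of two copies of \<open>r3\<close>, and its coprojections are identities.\<close>
  define p where "p = (\<lambda>i j. if i = 1 then (if j = (2::nat) then p12 else p13)
      else if i = (2::nat) then p23 else Id C (Cod C r3))"
  define q where "q = (\<lambda>i j. if i = 1 then (if j = (2::nat) then q12 else q13)
      else if i = (2::nat) then q23 else Id C (Cod C r3))"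
  define D where "D = (\<lambda>i j. Cod C (p i j))"
  let ?G = "pairwise_diagram n B D p q"
  have rr: "r i \<in> Hom C X (B i) \<and> regular_epi C (r i)" for i
    using assms(3-8) by (auto simp: r_def B_def sel_def)
  have rpo: "is_pushout C (r i) (r j) (p i j) (q i j)" if "1 \<le> i" "i < j" "j \<le> n" for i j
    using that po pushout_regular_epi_self[OF \<open>regular_epi C r3\<close>]
    by (auto simp: r_def sel_def p_def q_def)
  have "p i j \<in> Hom C (B i) (D i j) \<and> q i j \<in> Hom C (B j) (D i j)"
    if "1 \<le> i" "i < j" "j \<le> n" for i j
    using pushoutD[OF rpo[OF that]] by (simp add: B_def D_def)
  then have pq: "\<forall>i j. 1 \<le> i \<and> i < j \<and> j \<le> n \<longrightarrow>
      p i j \<in> Hom C (B i) (D i j) \<and> q i j \<in> Hom C (B j) (D i j)" by blast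
  have bb: "b i \<in> Hom C T (B i)" for i
    using assms(12-14) by (simp add: b_def B_def r_def sel_def)
  have beq: "p i j \<odot> b i = q i j \<odot> b j" if "1 \<le> i" "i < j" "j \<le> n" for i j
    using that eq assms(14) by (auto simp: b_def p_def q_def sel_def)
  have T: "T \<in> Obj C" "X \<in> Obj C" using bb[of 0] rr[of 0] by auto
  have "is_diagram C ?G"
    by (rule is_diagram_pairwise) (use rr pq in \<open>auto simp: B_def\<close>)
  then obtain L l where L: "is_limit C ?G L l"
    using limit_exists[of ?G] finite_pairwise_diagram by blast
  note cone_iff = is_cone_pairwise_iff[of n p B D q, OF pq]
  have lc: "is_cone C ?G L l" using L by (simp add: is_limit_def)
  then have lB: "l (Base i) \<in> Hom C L (B i)" if "1 \<le> i" "i \<le> n" for i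
    using that cone_iff by blast
  have c1: "is_cone C ?G X (pairwise_cone C r p)"
    unfolding cone_iff pairwise_cone_def using T rr pushoutD(9)[OF rpo] by (simp del: Hom_iff)
  define c where "c = (\<lambda>v. case v of Base i \<Rightarrow> b i | Apex i j \<Rightarrow> p i j \<odot> b i)"
  have c2: "is_cone C ?G T c"
    unfolding cone_iff c_def using T bb beq by (simp del: Hom_iff)
  define h where "h = comparison C ?G L l X (pairwise_cone C r p)"
  have hr: "regular_epi C h"
    unfolding h_def
    by (rule pairwise_condition_comparison[OF cond rr pq rpo L])
  have h: "h \<in> Hom C X L \<and> (\<forall>i. 1 \<le> i \<and> i \<le> n \<longrightarrow> l (Base i) \<odot> h = r i)"
    using comparison_mediates[OF L c1]
    unfolding h_def[symmetric] mediates_pairwise_iff[of n p B D q, OF pq lc c1] by (simp add: pairwise_cone_def)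
  obtain k where "mediates C ?G L l T c k" using L c2 unfolding is_limit_def by blast
  then have k: "k \<in> Hom C T L \<and> (\<forall>i. 1 \<le> i \<and> i \<le> n \<longrightarrow> l (Base i) \<odot> k = b i)"
    unfolding mediates_pairwise_iff[of n p B D q, OF pq lc c2] by (simp add: c_def)
  \<comment> \<open>The compatible family is the point \<open>k\<close> of the limit, and a local
    lift of it along the comparison morphism \<open>h\<close> solves the remainder problem.\<close>
  obtain e x where e: "regular_epi C e" "Cod C e = T" "x \<in> Hom C (Dom C e) X" "h \<odot> x = k \<odot> e"
    using regular_epi_lift[OF hr, of k] h k by auto
  have eA: "e \<in> Arr C" using e by simp
  have main: "r i \<odot> x = b i \<odot> e" if i: "1 \<le> i" "i \<le> n" for i
  proof -
    have lh: "l (Base i) \<odot> h = r i" and lk: "l (Base i) \<odot> k = b i" using h k i by auto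
    have "r i \<odot> x = l (Base i) \<odot> (h \<odot> x)"
      by (rule Comp_rewrite[OF lh, symmetric]) (use h e(3) lB[OF i] in auto)
    also have "\<dots> = l (Base i) \<odot> (k \<odot> e)" using e by simp
    also have "\<dots> = b i \<odot> e"
      by (rule Comp_rewrite[OF lk]) (use k e(2) eA lB[OF i] in auto)
    finally show ?thesis .
  qed
  show ?thesis
    using that[OF e(1-3)] main[of 1] main[of 2] main[of 3] n by (simp add: r_def b_def sel_def)
qed

lemma reflexive_relation_kernel_pair_if_pairwise_condition:
  assumes cond: "pairwise_condition C n" and n: "n \<ge> 3"
    and R: "is_relation C X P p q m" and rx: "is_reflexive C X p q m"
  obtains f where "is_kernel_pair C f (p \<odot> m) (q \<odot> m)"
proof -
  define d c where dc: "d = p \<odot> m" "c = q \<odot> m"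
  have D: "X \<in> Obj C" "d \<in> Arr C" "c \<in> Arr C" "Dom C d = Dom C m" "Dom C c = Dom C m" "Cod C d = X" "Cod C c = X"
    unfolding dc using relationD[OF R] by auto
  obtain s where s: "s \<in> Hom C X (Dom C m)" "d \<odot> s = Id C X" "c \<odot> s = Id C X"
    using rx unfolding is_reflexive_def dc by blast
  \<comment> \<open>The common section provided by reflexivity splits both legs, so the pairwise
    condition applies to them.\<close>
  have reg: "regular_epi C d" "regular_epi C c"
    by (rule split_epi_regular[OF s(2)], use s(1) D in simp_all)
      (rule split_epi_regular[OF s(3)], use s(1) D in simp_all)
  obtain u v where po: "is_pushout C d c u v"
    using pushout_exists_if_pairwise_condition[OF cond n reg] D by auto
  note E = pushoutD[OF po]
  have "u \<odot> (d \<odot> s) = v \<odot> (c \<odot> s)"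
    by (rule Comp_cong_right[OF E(9)]) (use E(1-8) s(1) D in auto)
  \<comment> \<open>Precomposing the pushout square with the common section leaves only the
    coprojections.\<close>
  then have uv: "v = u" using s(2,3) E(4-7) D by simp
  have eq: "u \<odot> d = u \<odot> c" using E(9) uv by simp
  have po2: "is_pushout C c c (Id C (Cod C c)) (Id C (Cod C c))"
    by (rule pushout_regular_epi_self[OF reg(2)])
  have rel: "related C p q m a b \<longleftrightarrow> u \<odot> a = u \<odot> b"
    if ab: "a \<in> Hom C T X" "b \<in> Hom C T X" for T a b
  proof
    assume "related C p q m a b"
    then obtain h where h: "h \<in> Hom C T (Dom C m)" "d \<odot> h = a" "c \<odot> h = b"
      using ab unfolding related_def dc by auto
    show "u \<odot> a = u \<odot> b"
      unfolding h(2,3)[symmetric] by (rule Comp_cong_right[OF eq]) (use h(1) D E(4,6) in auto)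
  next
    assume "u \<odot> a = u \<odot> b"
    then have ub: "u \<odot> a = v \<odot> b" using uv by simp
    \<comment> \<open>The family is \<open>(a, b, b)\<close>, whose last two entries are trivially
      compatible. The lift \<open>x\<close> is an element of the relation itself and exhibits
      \<open>a\<close> and \<open>b\<close> as related over \<open>e\<close>.\<close>
    obtain e x where e: "regular_epi C e" "Cod C e = T" "x \<in> Hom C (Dom C e) (Dom C m)"
      "d \<odot> x = a \<odot> e" "c \<odot> x = b \<odot> e"
      by (rule remainder_if_pairwise_condition[OF cond n reg(1) reg(2) reg(2) D(4,5,5) po po po2 _ _ _ ub ub refl, of T])
        (use ab D in auto)
    have "related C p q m (d \<odot> x) (c \<odot> x)"
      unfolding dc by (rule related_legs[OF R]) (use e(3) in auto)
    then have "related C p q m (a \<odot> e) (b \<odot> e)" unfolding e(4,5) .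
    then show "related C p q m a b" using related_descent[OF R e(1,2) ab] by blast
  qed
  have "is_kernel_pair C u (p \<odot> m) (q \<odot> m)"
    by (rule kernel_pair_of_related[OF R]) (use E(4,6) D rel in auto)
  then show ?thesis using that by blast
qed

lemma exact_maltsev_if_pairwise_condition:
  assumes cond: "pairwise_condition C n" and n: "n \<ge> 3"
  shows "exact_maltsev_category C"
proof
  show "is_effective C p q m" if "is_equivalence_relation C X P p q m" for X P p q m
    using reflexive_relation_kernel_pair_if_pairwise_condition[OF cond n, of X P p q m] that
    by (auto simp: is_equivalence_relation_def is_effective_def)
  show "is_equivalence_relation C X P p q m" if "is_relation C X P p q m" "is_reflexive C X p q m" for X P p q m
    using reflexive_relation_kernel_pair_if_pairwise_condition[OF cond n that]
      kernel_pair_equivalence_relation[OF that(1)] by blast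
qed

lemma kernels_distribute_if_pairwise_condition:
  assumes cond: "pairwise_condition C n" and n: "n \<ge> 3"
  shows "kernels_distribute C X"
  unfolding kernels_distribute_def
proof (intro allI impI, elim conjE)
  fix r s t T a b
  assume reg: "regular_epi C r" "regular_epi C s" "regular_epi C t"
    and dom: "Dom C r = X" "Dom C s = X" "Dom C t = X"
    and ab: "a \<in> Hom C T X" "b \<in> Hom C T X" and eq: "r \<odot> a = r \<odot> b" and comp: "kernel_composite C s t a b"
  have A: "r \<in> Arr C" "s \<in> Arr C" "t \<in> Arr C" using reg by auto
  obtain e z where e: "regular_epi C e" "Cod C e = T" "z \<in> Hom C (Dom C e) X"
    "s \<odot> (a \<odot> e) = s \<odot> z" "t \<odot> z = t \<odot> (b \<odot> e)"
    using comp ab dom unfolding kernel_composite_def by auto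
  have eA: "e \<in> Arr C" using e by simp
  obtain p12 q12 where 12: "is_pushout C r s p12 q12"
    using pushout_exists_if_pairwise_condition[OF cond n reg(1,2)] dom by auto
  obtain p13 q13 where 13: "is_pushout C r t p13 q13"
    using pushout_exists_if_pairwise_condition[OF cond n reg(1,3)] dom by auto
  obtain p23 q23 where 23: "is_pushout C s t p23 q23"
    using pushout_exists_if_pairwise_condition[OF cond n reg(2,3)] dom by auto
  note E12 = pushoutD[OF 12] and E13 = pushoutD[OF 13] and E23 = pushoutD[OF 23]
  \<comment> \<open>Compatibility of \<open>(r \<odot> a, s \<odot> a, t \<odot> b)\<close>: the
    first two entries come from \<open>a\<close>; the first and third come from \<open>b\<close>,
    since \<open>r\<close> identifies \<open>a\<close> and \<open>b\<close>; the last two come, over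
    the cover \<open>e\<close>, from the intermediate element \<open>z\<close>.\<close>
  have c12: "p12 \<odot> (r \<odot> a) = q12 \<odot> (s \<odot> a)"
    by (rule Comp_cong_right[OF E12(9)]) (use E12(4-8) A dom ab in auto)
  have "p13 \<odot> (r \<odot> b) = q13 \<odot> (t \<odot> b)"
    by (rule Comp_cong_right[OF E13(9)]) (use E13(4-8) A dom ab in auto)
  then have c13: "p13 \<odot> (r \<odot> a) = q13 \<odot> (t \<odot> b)" using eq by simp
  have "p23 \<odot> (s \<odot> z) = q23 \<odot> (t \<odot> z)"
    by (rule Comp_cong_right[OF E23(9)]) (use E23(4-8) A dom e(3) in auto)
  then have "p23 \<odot> (s \<odot> (a \<odot> e)) = q23 \<odot> (t \<odot> (b \<odot> e))" using e by simp
  then have "(p23 \<odot> (s \<odot> a)) \<odot> e = (q23 \<odot> (t \<odot> b)) \<odot> e" using E23(4-8) A dom ab e(2) eA by simp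
  then have c23: "p23 \<odot> (s \<odot> a) = q23 \<odot> (t \<odot> b)"
    by (rule regular_epi_cancel[OF e(1)]) (use E23(4-8) A dom ab e(2) in auto)
  obtain e' w where w: "regular_epi C e'" "Cod C e' = T" "w \<in> Hom C (Dom C e') X"
    "r \<odot> w = (r \<odot> a) \<odot> e'" "s \<odot> w = (s \<odot> a) \<odot> e'" "t \<odot> w = (t \<odot> b) \<odot> e'"
    by (rule remainder_if_pairwise_condition[OF cond n reg dom 12 13 23 _ _ _ c12 c13 c23, of T])
      (use A ab dom in auto)
  have "e' \<in> Arr C" using w by simp
  then have "r \<odot> w = r \<odot> (a \<odot> e')" "s \<odot> w = s \<odot> (a \<odot> e')" "t \<odot> w = t \<odot> (b \<odot> e')"
    using w(2,4-6) A ab dom by auto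
  then show "\<exists>e w. regular_epi C e \<and> Cod C e = T \<and> w \<in> Hom C (Dom C e) X \<and>
      r \<odot> w = r \<odot> (a \<odot> e) \<and> s \<odot> w = s \<odot> (a \<odot> e) \<and> t \<odot> w = t \<odot> (b \<odot> e)"
    using w(1-3) by blast
qed

lemma exact_arithmetical_if_pairwise_condition:
  assumes cond: "pairwise_condition C n" and n: "n \<ge> 3"
  shows "exact_arithmetical_category C"
proof -
  interpret E: exact_maltsev_category C by (rule exact_maltsev_if_pairwise_condition[OF assms])
  show ?thesis
    using E.distributive_if_kernels_distribute[OF _ kernels_distribute_if_pairwise_condition[OF assms]]
    by (intro exact_arithmetical_category.intro E.exact_category_axioms E.maltsev_category_axioms
        exact_arithmetical_category_axioms.intro)
qed

end

section \<open>The remainder theorem in arithmetical categories\<close>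

context exact_maltsev_category
begin

text \<open>The pairing in \<open>kernel_extent_Int\<close> need not be a regular epimorphism; the
  quotient by the equivalence relation that it defines has the same kernel and is one.\<close>

lemma regular_kernel_Int:
  assumes f: "regular_epi C f" "Dom C f = X" and g: "regular_epi C g" "Dom C g = X"
  obtains k where "regular_epi C k" "Dom C k = X" "kernel_extent C k = kernel_extent C f \<inter> kernel_extent C g"
proof -
  have X: "X \<in> Obj C" using f by (metis Dom_Obj regular_epi_Arr)
  obtain P p q where pr: "is_product C X X P p q" using product_exists[OF X X] by blast
  obtain x where x: "x \<in> carrier (Equiv C X P p q)" "extent C X p q x = kernel_extent C f"
    by (rule kernel_extent_exists[OF regular_epi_Arr[OF f(1)] f(2) pr])
  obtain y where y: "y \<in> carrier (Equiv C X P p q)" "extent C X p q y = kernel_extent C g"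
    by (rule kernel_extent_exists[OF regular_epi_Arr[OF g(1)] g(2) pr])
  obtain m where m: "m \<in> carrier (Equiv C X P p q)" "extent C X p q m = extent C X p q x \<inter> extent C X p q y"
    by (rule meet_extent_exists[OF x(1) y(1)])
  obtain k where k: "regular_epi C k" "Dom C k = X" "extent C X p q m = kernel_extent C k"
    by (rule equivalence_relation_kernel_extent[OF m(1)])
  show ?thesis using that[OF k(1,2)] k(3) m(2) x(2) y(2) by simp
qed

lemma regular_kernel_join:
  assumes f: "regular_epi C f" "Dom C f = X" and g: "regular_epi C g" "Dom C g = X"
  obtains k where "regular_epi C k" "Dom C k = X"
    "\<And>T a b. a \<in> Hom C T X \<Longrightarrow> b \<in> Hom C T X \<Longrightarrow> k \<odot> a = k \<odot> b \<longleftrightarrow> kernel_composite C f g a b"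
proof -
  have X: "X \<in> Obj C" using f by (metis Dom_Obj regular_epi_Arr)
  obtain P p q where pr: "is_product C X X P p q" using product_exists[OF X X] by blast
  obtain j where j: "j \<in> carrier (Equiv C X P p q)" "extent C X p q j =
         {(a, b). \<exists>T. a \<in> Hom C T X \<and> b \<in> Hom C T X \<and> kernel_composite C f g a b}"
    by (rule join_extent_exists[OF regular_epi_Arr[OF f(1)] f(2) regular_epi_Arr[OF g(1)] g(2) pr])
  obtain k where k: "regular_epi C k" "Dom C k = X" "extent C X p q j = kernel_extent C k"
    by (rule equivalence_relation_kernel_extent[OF j(1)])
  have "k \<odot> a = k \<odot> b \<longleftrightarrow> kernel_composite C f g a b" if ab: "a \<in> Hom C T X" "b \<in> Hom C T X" for T a b
  proof -
    have "k \<odot> a = k \<odot> b \<longleftrightarrow> (a, b) \<in> kernel_extent C k"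
      unfolding kernel_extent_def k(2) using ab by blast
    also have "\<dots> \<longleftrightarrow> (a, b) \<in> extent C X p q j" using k by simp
    also have "\<dots> \<longleftrightarrow> kernel_composite C f g a b" unfolding j(2) using ab by blast
    finally show ?thesis .
  qed
  then show ?thesis using that k by blast
qed

text \<open>The pair that \<open>f\<close> coequalizes belongs to the kernel of \<open>f\<close>,
  hence to that of \<open>k\<close>; no other pair has to be tested.\<close>

lemma regular_epi_factor:
  assumes f: "regular_epi C f" "Dom C f = X" and k: "k \<in> Arr C" "Dom C k = X"
    and sub: "kernel_extent C f \<subseteq> kernel_extent C k"
  obtains h where "h \<in> Hom C (Cod C f) (Cod C k)" "h \<odot> f = k"
proof -
  obtain u v where uv: "is_coequalizer C u v f" using f regular_epiE by blast
  then have U: "u \<in> Hom C (Dom C u) X" "v \<in> Hom C (Dom C u) X" "Cod C u = X" "f \<odot> u = f \<odot> v"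
    using f unfolding is_coequalizer_def by auto
  have "(u, v) \<in> kernel_extent C f" unfolding kernel_extent_def f(2) using U by blast
  then have "k \<odot> u = k \<odot> v" using sub unfolding kernel_extent_def by blast
  then show ?thesis using coequalizer_factor[OF uv k(1)] k U(3) that by metis
qed

text \<open>The pushout of two regular epimorphisms is the quotient by the join of their kernels.\<close>

lemma pushout_of_regular_epis:
  assumes f: "regular_epi C f" "Dom C f = X" and g: "regular_epi C g" "Dom C g = X"
  obtains p q where "is_pushout C f g p q"
    "\<And>T a b. a \<in> Hom C T X \<Longrightarrow> b \<in> Hom C T X \<Longrightarrow> p \<odot> (f \<odot> a) = p \<odot> (f \<odot> b) \<Longrightarrow> kernel_composite C f g a b"
proof -
  have A: "f \<in> Arr C" "g \<in> Arr C" using f g by auto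
  obtain k where k: "regular_epi C k" "Dom C k = X"
    and kc: "\<And>T a b. a \<in> Hom C T X \<Longrightarrow> b \<in> Hom C T X \<Longrightarrow> k \<odot> a = k \<odot> b \<longleftrightarrow> kernel_composite C f g a b"
    using regular_kernel_join[OF f g] by blast
  have kA: "k \<in> Arr C" using k by simp
  \<comment> \<open>As \<open>k\<close> is the quotient by the join, it factors through both
    \<open>f\<close> and \<open>g\<close>; the two factors are the coprojections.\<close>
  have "kernel_extent C f \<subseteq> kernel_extent C k"
  proof (rule subrelI)
    fix a b assume "(a, b) \<in> kernel_extent C f"
    then obtain T where ab: "a \<in> Hom C T X" "b \<in> Hom C T X" "f \<odot> a = f \<odot> b"
      unfolding kernel_extent_def f(2) by blast
    have "kernel_composite C f g a b"
      by (rule kernel_extent_le_composite[where T = T]) (use A f(2) g(2) ab in auto)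
    then show "(a, b) \<in> kernel_extent C k" unfolding kernel_extent_def k(2) using ab kc by blast
  qed
  then obtain p where p: "p \<in> Hom C (Cod C f) (Cod C k)" "p \<odot> f = k"
    by (rule regular_epi_factor[OF f kA k(2)])
  have "kernel_extent C g \<subseteq> kernel_extent C k"
  proof (rule subrelI)
    fix a b assume "(a, b) \<in> kernel_extent C g"
    then obtain T where ab: "a \<in> Hom C T X" "b \<in> Hom C T X" "g \<odot> a = g \<odot> b"
      unfolding kernel_extent_def g(2) by blast
    have "kernel_composite C f g a b"
      by (rule kernel_extent_le_composite[where T = T]) (use A f(2) g(2) ab in auto)
    then show "(a, b) \<in> kernel_extent C k" unfolding kernel_extent_def k(2) using ab kc by blast
  qed
  then obtain q where q: "q \<in> Hom C (Cod C g) (Cod C k)" "q \<odot> g = k"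
    by (rule regular_epi_factor[OF g kA k(2)])
  have pA: "p \<in> Arr C" "Dom C p = Cod C f" "Cod C p = Cod C k" and qA: "q \<in> Arr C" "Dom C q = Cod C g" "Cod C q = Cod C k"
    using p(1) q(1) by auto
  have "is_pushout C f g p q"
    unfolding is_pushout_def
  proof (intro conjI allI impI)
    fix Y u v assume uv: "u \<in> Hom C (Cod C f) Y \<and> v \<in> Hom C (Cod C g) Y \<and> u \<odot> f = v \<odot> g"
    have u: "u \<in> Arr C" "Dom C u = Cod C f" "Cod C u = Y" and v: "v \<in> Arr C" "Dom C v = Cod C g" "Cod C v = Y"
      using uv by auto
    define w where "w = u \<odot> f"
    have "w \<in> Arr C" "Dom C w = X" "Cod C w = Y" "u \<odot> f = w"
      unfolding w_def using u A f(2) by auto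
    moreover have "v \<odot> g = w" unfolding w_def using uv by metis
    ultimately have w: "w \<in> Arr C" "Dom C w = X" "Cod C w = Y" "u \<odot> f = w" "v \<odot> g = w" by blast+
    \<comment> \<open>The common composite \<open>w\<close> factors through \<open>f\<close> and
      through \<open>g\<close>, so its kernel contains both kernels and therefore their join. Hence
      \<open>w\<close> factors through \<open>k\<close>.\<close>
    have "kernel_extent C k \<subseteq> kernel_extent C w"
    proof (rule subrelI)
      fix a b assume "(a, b) \<in> kernel_extent C k"
      then obtain T where ab: "a \<in> Hom C T X" "b \<in> Hom C T X" "k \<odot> a = k \<odot> b"
        unfolding kernel_extent_def k(2) by blast
      have comp: "kernel_composite C f g a b" using kc ab by blast
      have sub: "kernel_extent C h \<subseteq> kernel_extent C w"
        if h: "h \<in> Arr C" "Dom C h = X" "h' \<in> Arr C" "Dom C h' = Cod C h" "h' \<odot> h = w" for h h'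
      proof (rule subrelI)
        fix c d assume "(c, d) \<in> kernel_extent C h"
        then obtain T' where cd: "c \<in> Hom C T' X" "d \<in> Hom C T' X" "h \<odot> c = h \<odot> d"
          unfolding kernel_extent_def h(2) by blast
        have "w \<odot> c = h' \<odot> (h \<odot> c)" "w \<odot> d = h' \<odot> (h \<odot> d)"
          by (rule Comp_rewrite[OF h(5), symmetric], use h(1-4) cd(1) in simp_all)
            (rule Comp_rewrite[OF h(5), symmetric], use h(1-4) cd(2) in simp_all)
        then show "(c, d) \<in> kernel_extent C w"
          unfolding kernel_extent_def w(2) using cd by auto
      qed
      have "w \<odot> a = w \<odot> b"
        by (rule kernel_extent_mono_composite[OF w(1,2) A(1) f(2) A(2) g(2)
            sub[OF A(1) f(2) u(1,2) w(4)] sub[OF A(2) g(2) v(1,2) w(5)] ab(1,2) comp])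
      then show "(a, b) \<in> kernel_extent C w" unfolding kernel_extent_def w(2) using ab by blast
    qed
    then obtain h where h: "h \<in> Hom C (Cod C k) (Cod C w)" "h \<odot> k = w"
      by (rule regular_epi_factor[OF k w(1,2)])
    have hA: "h \<in> Arr C" "Dom C h = Cod C k" "Cod C h = Y" using h(1) w(3) by auto
    have "(h \<odot> p) \<odot> f = h \<odot> k" unfolding p(2)[symmetric] by (rule Comp_assoc') (use hA pA A in auto)
    then have "(h \<odot> p) \<odot> f = u \<odot> f" using h(2) w(4) by simp
    then have hp: "h \<odot> p = u" by (rule regular_epi_cancel[OF f(1)]) (use hA pA u in auto)
    have "(h \<odot> q) \<odot> g = h \<odot> k" unfolding q(2)[symmetric] by (rule Comp_assoc') (use hA qA A in auto)
    then have "(h \<odot> q) \<odot> g = v \<odot> g" using h(2) w(5) by simp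
    then have hq: "h \<odot> q = v" by (rule regular_epi_cancel[OF g(1)]) (use hA qA v in auto)
    have unique: "h' = h" if h': "h' \<in> Arr C" "Dom C h' = Cod C k" "h' \<odot> p = u" for h'
    proof -
      have "h' \<odot> (p \<odot> f) = u \<odot> f" by (rule Comp_rewrite[OF h'(3)]) (use h'(1,2) pA A in auto)
      then have "h' \<odot> k = h \<odot> k" using p(2) h(2) w(4) by simp
      then show ?thesis by (rule regular_epi_cancel[OF k(1)]) (use h'(1,2) hA in auto)
    qed
    show "\<exists>!h. h \<in> Hom C (Cod C p) Y \<and> h \<odot> p = u \<and> h \<odot> q = v"
    proof (rule ex1I[of _ h])
      show "h \<in> Hom C (Cod C p) Y \<and> h \<odot> p = u \<and> h \<odot> q = v" using hA hp hq pA by simp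
      show "h' = h" if "h' \<in> Hom C (Cod C p) Y \<and> h' \<odot> p = u \<and> h' \<odot> q = v" for h'
        using unique[of h'] that pA(3) by auto
    qed
  qed (use A f(2) g(2) pA qA p(2) q(2) in auto)
  moreover have "kernel_composite C f g a b"
    if ab: "a \<in> Hom C T X" "b \<in> Hom C T X" "p \<odot> (f \<odot> a) = p \<odot> (f \<odot> b)" for T a b
  proof -
    have "p \<odot> (f \<odot> a) = k \<odot> a" "p \<odot> (f \<odot> b) = k \<odot> b"
      by (rule Comp_rewrite[OF p(2)], use pA A f(2) ab(1) in simp_all)
        (rule Comp_rewrite[OF p(2)], use pA A f(2) ab(2) in simp_all)
    then have "k \<odot> a = k \<odot> b" using ab(3) by metis
    then show ?thesis using kc ab(1,2) by blast
  qed
  ultimately show ?thesis using that by blast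
qed

text \<open>Passes from the pushout constructed in \<open>pushout_of_regular_epis\<close> to an
  arbitrary one: whatever \<open>p\<close> identifies is identified by its composite with the
  comparison to the constructed pushout.\<close>

lemma kernel_composite_if_pushout_identifies:
  assumes f: "regular_epi C f" "Dom C f = X" and g: "regular_epi C g" "Dom C g = X"
    and po: "is_pushout C f g p q"
    and ab: "a \<in> Hom C T X" "b \<in> Hom C T X" and eq: "p \<odot> (f \<odot> a) = p \<odot> (f \<odot> b)"
  shows "kernel_composite C f g a b"
proof -
  obtain p' q' where po': "is_pushout C f g p' q'"
    and comp: "\<And>T a b. a \<in> Hom C T X \<Longrightarrow> b \<in> Hom C T X \<Longrightarrow> p' \<odot> (f \<odot> a) = p' \<odot> (f \<odot> b) \<Longrightarrow>
      kernel_composite C f g a b"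
    using pushout_of_regular_epis[OF f g] by blast
  note E = pushoutD[OF po] and E' = pushoutD[OF po']
  have "p' \<in> Hom C (Cod C f) (Cod C p')" "q' \<in> Hom C (Cod C g) (Cod C p')" using E' by auto
  then obtain h where h: "h \<in> Hom C (Cod C p) (Cod C p')" "h \<odot> p = p'"
    using po E'(9) unfolding is_pushout_def by blast
  have "h \<odot> (p \<odot> (f \<odot> a)) = p' \<odot> (f \<odot> a)" "h \<odot> (p \<odot> (f \<odot> b)) = p' \<odot> (f \<odot> b)"
    by (rule Comp_rewrite[OF h(2)], use h(1) E(1,4,6) f(2) ab(1) in simp_all)
      (rule Comp_rewrite[OF h(2)], use h(1) E(1,4,6) f(2) ab(2) in simp_all)
  then show ?thesis using comp[OF ab] eq by simp
qed

text \<open>The dual distributive law \<open>(F \<or> T) \<and> (G \<or> T) \<le> (F \<and> G) \<or> T\<close> for kernels, by two applications of the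
  distributive law.\<close>

lemma meet_kernel_composite:
  assumes kd: "kernels_distribute C X"
    and f: "regular_epi C f" "Dom C f = X" and g: "regular_epi C g" "Dom C g = X"
    and k: "regular_epi C k" "Dom C k = X" "kernel_extent C k = kernel_extent C f \<inter> kernel_extent C g"
    and t: "regular_epi C t" "Dom C t = X"
    and ab: "a \<in> Hom C T X" "b \<in> Hom C T X"
    and comp: "kernel_composite C f t a b" "kernel_composite C g t a b"
  shows "kernel_composite C k t a b"
proof -
  have A: "f \<in> Arr C" "g \<in> Arr C" "k \<in> Arr C" "t \<in> Arr C" using f g k t by auto
  obtain j where j: "regular_epi C j" "Dom C j = X"
    and jc: "\<And>T a b. a \<in> Hom C T X \<Longrightarrow> b \<in> Hom C T X \<Longrightarrow> j \<odot> a = j \<odot> b \<longleftrightarrow> kernel_composite C f t a b"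
    using regular_kernel_join[OF f t] by blast
  have "j \<odot> a = j \<odot> b" using jc ab comp by blast
  then obtain e w where e: "regular_epi C e" "Cod C e = T" "w \<in> Hom C (Dom C e) X"
    \<comment> \<open>First application, with \<open>j\<close>, the quotient by the join of the
      kernels of \<open>f\<close> and \<open>t\<close>, in the role of \<open>r\<close>, and
      \<open>g\<close> in that of \<open>s\<close>.\<close>
    and w: "j \<odot> w = j \<odot> (a \<odot> e)" "g \<odot> w = g \<odot> (a \<odot> e)" "t \<odot> w = t \<odot> (b \<odot> e)"
    using kd ab comp j g t unfolding kernels_distribute_def by metis
  have eA: "e \<in> Arr C" using e by simp
  have ae: "a \<odot> e \<in> Hom C (Dom C e) X" "b \<odot> e \<in> Hom C (Dom C e) X" using ab eA e(2) by auto
  have "kernel_composite C f t (a \<odot> e) w" using jc[OF ae(1) e(3)] w by simp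
  moreover have "g \<odot> (a \<odot> e) = g \<odot> w" using w by simp
  \<comment> \<open>Second application, from \<open>a\<close> to \<open>w\<close>, with
    \<open>g\<close> in the role of \<open>r\<close> and \<open>f\<close> in that of
    \<open>s\<close>. The new point agrees with \<open>a\<close> under \<open>f\<close> and
    \<open>g\<close>, and under \<open>t\<close> with \<open>w\<close>, hence with
    \<open>b\<close>.\<close>
  ultimately obtain e2 w2 where e2: "regular_epi C e2" "Cod C e2 = Dom C e" "w2 \<in> Hom C (Dom C e2) X"
    and w2: "g \<odot> w2 = g \<odot> ((a \<odot> e) \<odot> e2)" "f \<odot> w2 = f \<odot> ((a \<odot> e) \<odot> e2)" "t \<odot> w2 = t \<odot> (w \<odot> e2)"
    using kd ae(1) e(3) f g t unfolding kernels_distribute_def by metis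
  have e2A: "e2 \<in> Arr C" using e2 by simp
  have assoc: "(a \<odot> e) \<odot> e2 = a \<odot> (e \<odot> e2)" "(b \<odot> e) \<odot> e2 = b \<odot> (e \<odot> e2)"
    using ab eA e(2) e2A e2(2) by auto
  have aee: "a \<odot> (e \<odot> e2) \<in> Hom C (Dom C e2) X" using ab eA e(2) e2A e2(2) by auto
  have "(a \<odot> (e \<odot> e2), w2) \<in> kernel_extent C k"
    unfolding k(3) unfolding kernel_extent_def f(2) g(2) using aee e2(3) w2(1,2) assoc(1) by auto
  then have kw: "k \<odot> (a \<odot> (e \<odot> e2)) = k \<odot> w2" unfolding kernel_extent_def by blast
  have "t \<odot> (w \<odot> e2) = t \<odot> ((b \<odot> e) \<odot> e2)"
    by (rule Comp_cong_right[OF w(3)]) (use A t(2) e(3) ae e2A e2(2) in auto)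
  then have "t \<odot> w2 = t \<odot> (b \<odot> (e \<odot> e2))" using w2(3) assoc(2) by simp
  moreover have "regular_epi C (e \<odot> e2)" using regular_epi_comp[OF e2(1) e(1)] e2(2) by simp
  moreover have "Cod C (e \<odot> e2) = Dom C a" "Dom C (e \<odot> e2) = Dom C e2" using ab(1) e(2) eA e2A e2(2) by auto
  ultimately show ?thesis
    unfolding kernel_composite_def using kw e2(3) k(2) by metis
qed

text \<open>Here \<open>f\<close> is the quotient by the meet of all the kernels, and the last
  conjunct is the dual distributive law for \<open>k\<close> factors. Each inductive step meets
  \<open>f\<close> with one more kernel and uses the binary law.\<close>

lemma finite_meet_kernel_composite:
  fixes k :: nat
  assumes kd: "kernels_distribute C X" and "1 \<le> k"
    and r: "\<And>i. 1 \<le> i \<Longrightarrow> i \<le> k \<Longrightarrow> regular_epi C (r i) \<and> Dom C (r i) = X"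
  shows "\<exists>f. regular_epi C f \<and> Dom C f = X \<and>
    (\<forall>T a b. a \<in> Hom C T X \<and> b \<in> Hom C T X \<longrightarrow>
       (f \<odot> a = f \<odot> b \<longleftrightarrow> (\<forall>i. 1 \<le> i \<and> i \<le> k \<longrightarrow> r i \<odot> a = r i \<odot> b))) \<and>
    (\<forall>t T a b. regular_epi C t \<and> Dom C t = X \<and> a \<in> Hom C T X \<and> b \<in> Hom C T X \<and>
       (\<forall>i. 1 \<le> i \<and> i \<le> k \<longrightarrow> kernel_composite C (r i) t a b) \<longrightarrow> kernel_composite C f t a b)"
  using assms(2) r
proof (induction k rule: dec_induct)
  case base
  have "(\<forall>i. 1 \<le> i \<and> i \<le> (1::nat) \<longrightarrow> P i) \<longleftrightarrow> P 1" for P using le_antisym by auto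
  then show ?case using base by (intro exI[of _ "r 1"]) (auto simp del: Hom_iff)
next
  case (step k)
  have r': "regular_epi C (r i) \<and> Dom C (r i) = X" if "1 \<le> i" "i \<le> k" for i using step.prems that by simp
  obtain f where f: "regular_epi C f" "Dom C f = X"
    and ker: "\<forall>T a b. a \<in> Hom C T X \<and> b \<in> Hom C T X \<longrightarrow>
      (f \<odot> a = f \<odot> b \<longleftrightarrow> (\<forall>i. 1 \<le> i \<and> i \<le> k \<longrightarrow> r i \<odot> a = r i \<odot> b))"
    and comp: "\<forall>t T a b. regular_epi C t \<and> Dom C t = X \<and> a \<in> Hom C T X \<and> b \<in> Hom C T X \<and>
      (\<forall>i. 1 \<le> i \<and> i \<le> k \<longrightarrow> kernel_composite C (r i) t a b) \<longrightarrow> kernel_composite C f t a b"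
    using step.IH[OF r'] by blast
  have g: "regular_epi C (r (Suc k))" "Dom C (r (Suc k)) = X" using step.prems[of "Suc k"] by auto
  obtain h where h: "regular_epi C h" "Dom C h = X"
    "kernel_extent C h = kernel_extent C f \<inter> kernel_extent C (r (Suc k))"
    by (rule regular_kernel_Int[OF f g])
  have split: "(\<forall>i. 1 \<le> i \<and> i \<le> Suc k \<longrightarrow> P i) \<longleftrightarrow> (\<forall>i. 1 \<le> i \<and> i \<le> k \<longrightarrow> P i) \<and> P (Suc k)" for P
    using le_Suc_eq by auto
  have "h \<odot> a = h \<odot> b \<longleftrightarrow> (\<forall>i. 1 \<le> i \<and> i \<le> Suc k \<longrightarrow> r i \<odot> a = r i \<odot> b)"
    if ab: "a \<in> Hom C T X" "b \<in> Hom C T X" for T a b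
  proof -
    have mem: "(a, b) \<in> kernel_extent C m \<longleftrightarrow> m \<odot> a = m \<odot> b" if "Dom C m = X" for m
      unfolding kernel_extent_def that using ab by blast
    show ?thesis
      unfolding split mem[OF h(2), symmetric] h(3) Int_iff mem[OF f(2)] mem[OF g(2)] using ker ab by blast
  qed
  moreover have "kernel_composite C h t a b"
    if t: "regular_epi C t" "Dom C t = X" and ab: "a \<in> Hom C T X" "b \<in> Hom C T X"
      and all: "\<forall>i. 1 \<le> i \<and> i \<le> Suc k \<longrightarrow> kernel_composite C (r i) t a b" for t T a b
    using all comp t ab unfolding split
    by (intro meet_kernel_composite[OF kd f g h t ab]) blast+
  ultimately show ?case using h by blast
qed

text \<open>Let \<open>x\<close> solve the first \<open>k\<close> conditions and let
  \<open>y\<close> solve the next one. Compatibility with index \<open>i\<close> says that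
  \<open>x\<close> and \<open>y\<close> become equal in the pushout of \<open>r i\<close> and
  \<open>r (Suc k)\<close>, i.e. are linked by the composite of these two kernels. By the dual
  distributive law a single \<open>w\<close> serves all \<open>i\<close>: it agrees with
  \<open>x\<close> under the first \<open>k\<close> quotients and with \<open>y\<close> under the
  last.\<close>

lemma remainder_theorem:
  fixes n :: nat
  assumes kd: "kernels_distribute C X" and n: "1 \<le> n"
    and r: "\<And>i. 1 \<le> i \<Longrightarrow> i \<le> n \<Longrightarrow> regular_epi C (r i) \<and> Dom C (r i) = X"
    and po: "\<And>i j. 1 \<le> i \<Longrightarrow> i < j \<Longrightarrow> j \<le> n \<Longrightarrow> is_pushout C (r i) (r j) (p i j) (q i j)"
    and b: "\<And>i. 1 \<le> i \<Longrightarrow> i \<le> n \<Longrightarrow> b i \<in> Hom C T (Cod C (r i))"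
    and eq: "\<And>i j. 1 \<le> i \<Longrightarrow> i < j \<Longrightarrow> j \<le> n \<Longrightarrow> p i j \<odot> b i = q i j \<odot> b j"
  obtains e x where "regular_epi C e" "Cod C e = T" "x \<in> Hom C (Dom C e) X"
    "\<And>i. 1 \<le> i \<Longrightarrow> i \<le> n \<Longrightarrow> r i \<odot> x = b i \<odot> e"
proof -
  have "\<exists>e x. regular_epi C e \<and> Cod C e = T \<and> x \<in> Hom C (Dom C e) X \<and>
      (\<forall>i. 1 \<le> i \<and> i \<le> n \<longrightarrow> r i \<odot> x = b i \<odot> e)"
    using n r po b eq
  proof (induction n rule: dec_induct)
    case base
    have b1: "b 1 \<in> Arr C" "Dom C (b 1) = T" "Cod C (b 1) = Cod C (r 1)" using base.prems(3)[of 1] by auto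
    obtain e x where "regular_epi C e" "Cod C e = Dom C (b 1)" "x \<in> Hom C (Dom C e) (Dom C (r 1))"
      "r 1 \<odot> x = b 1 \<odot> e"
      by (rule regular_epi_lift[of "r 1" "b 1"]) (use base.prems(1)[of 1] b1 in auto)
    moreover have "i = 1" if "1 \<le> i \<and> i \<le> 1" for i :: nat using that by simp
    ultimately show ?case using b1 base.prems(1)[of 1] by (metis order_refl)
  next
    case (step k)
    have "\<exists>e x. regular_epi C e \<and> Cod C e = T \<and> x \<in> Hom C (Dom C e) X \<and>
        (\<forall>i. 1 \<le> i \<and> i \<le> k \<longrightarrow> r i \<odot> x = b i \<odot> e)"
      by (rule step.IH; use step.prems le_SucI in blast)
    then obtain e x where e: "regular_epi C e" "Cod C e = T" "x \<in> Hom C (Dom C e) X"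
      and ex: "\<forall>i. 1 \<le> i \<and> i \<le> k \<longrightarrow> r i \<odot> x = b i \<odot> e"
      by blast
    have eA: "e \<in> Arr C" using e by simp
    have R: "regular_epi C (r i)" "r i \<in> Arr C" "Dom C (r i) = X" if "1 \<le> i" "i \<le> Suc k" for i
      using step.prems(1)[OF that] by auto
    have B: "b i \<in> Arr C" "Dom C (b i) = T" "Cod C (b i) = Cod C (r i)" if "1 \<le> i" "i \<le> Suc k" for i
      using step.prems(3)[OF that] by auto
    let ?s = "r (Suc k)" and ?c = "b (Suc k)"
    have s: "regular_epi C ?s" "?s \<in> Arr C" "Dom C ?s = X" using R[of "Suc k"] by auto
    have c: "?c \<in> Arr C" "Dom C ?c = T" "Cod C ?c = Cod C ?s" using B[of "Suc k"] by auto
    obtain e2 y where e2: "regular_epi C e2" "Cod C e2 = Dom C (?c \<odot> e)" "y \<in> Hom C (Dom C e2) (Dom C ?s)"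
      and ey: "?s \<odot> y = (?c \<odot> e) \<odot> e2"
      by (rule regular_epi_lift[OF s(1), of "?c \<odot> e"]) (use c e(2) eA in auto)
    have e2A: "e2 \<in> Arr C" "Cod C e2 = Dom C e" using e2 c e(2) eA by auto
    have y: "y \<in> Hom C (Dom C e2) X" using e2(3) s(3) by simp
    have xe: "x \<odot> e2 \<in> Hom C (Dom C e2) X" using e(3) e2A by simp
    have "regular_epi C (r i) \<and> Dom C (r i) = X" if "1 \<le> i" "i \<le> k" for i
      using R(1,3)[of i] that by simp
    then obtain f where f: "regular_epi C f" "Dom C f = X"
      and ker: "\<forall>T a b. a \<in> Hom C T X \<and> b \<in> Hom C T X \<longrightarrow>
        (f \<odot> a = f \<odot> b \<longleftrightarrow> (\<forall>i. 1 \<le> i \<and> i \<le> k \<longrightarrow> r i \<odot> a = r i \<odot> b))"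
      and comp: "\<forall>t T a b. regular_epi C t \<and> Dom C t = X \<and> a \<in> Hom C T X \<and> b \<in> Hom C T X \<and>
        (\<forall>i. 1 \<le> i \<and> i \<le> k \<longrightarrow> kernel_composite C (r i) t a b) \<longrightarrow> kernel_composite C f t a b"
      using finite_meet_kernel_composite[OF kd step.hyps(1), of r] by blast
    have rx: "r i \<odot> (x \<odot> e2) = b i \<odot> (e \<odot> e2)" if i: "1 \<le> i" "i \<le> k" for i
    proof -
      have "r i \<odot> x = b i \<odot> e" using ex i by blast
      then show ?thesis
        by (rule Comp_cong_right) (use R(2,3)[of i] B[of i] i e(2,3) eA e2A in auto)
    qed
    \<comment> \<open>In the pushout, \<open>x\<close> represents the \<open>i\<close>-th entry of
      the family and \<open>y\<close> the last one; these agree there by hypothesis.\<close>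
    have "kernel_composite C (r i) ?s (x \<odot> e2) y" if i: "1 \<le> i" "i \<le> k" for i
    proof -
      have i': "1 \<le> i" "i < Suc k" "Suc k \<le> Suc k" "i \<le> Suc k" using i by auto
      have po: "is_pushout C (r i) ?s (p i (Suc k)) (q i (Suc k))" by (rule step.prems(2)[OF i'(1-3)])
      note E = pushoutD[OF po] and Ri = R[OF i'(1,4)] and Bi = B[OF i'(1,4)]
      have "p i (Suc k) \<odot> (r i \<odot> (x \<odot> e2)) = p i (Suc k) \<odot> (b i \<odot> (e \<odot> e2))" using rx[OF i] by simp
      also have "\<dots> = q i (Suc k) \<odot> (?c \<odot> (e \<odot> e2))"
        by (rule Comp_cong_right[OF step.prems(4)[OF i'(1-3)]]) (use E(4-8) Ri Bi c e(2) eA e2A in auto)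
      also have "\<dots> = q i (Suc k) \<odot> (?s \<odot> y)"
        using ey c(1,2) e(2) eA e2A by simp
      also have "\<dots> = p i (Suc k) \<odot> (r i \<odot> y)"
        by (rule Comp_cong_right[OF E(9)[symmetric]]) (use E(4-8) Ri s y in auto)
      finally show ?thesis
        by (rule kernel_composite_if_pushout_identifies[OF Ri(1,3) s(1,3) po xe y])
    qed
    then have "kernel_composite C f ?s (x \<odot> e2) y" using comp s(1,3) xe y by blast
    then obtain e3 w where e3: "regular_epi C e3" "Cod C e3 = Dom C e2" "w \<in> Hom C (Dom C e3) X"
      and fw: "f \<odot> ((x \<odot> e2) \<odot> e3) = f \<odot> w" and sw: "?s \<odot> w = ?s \<odot> (y \<odot> e3)"
      using xe f unfolding kernel_composite_def by auto
    have e3A: "e3 \<in> Arr C" using e3 by simp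
    \<comment> \<open>The covers accumulate: \<open>e\<close> carries \<open>x\<close>,
      \<open>e2\<close> the lift \<open>y\<close>, and \<open>e3\<close> the intermediate element
      \<open>w\<close>.\<close>
    let ?e = "e \<odot> (e2 \<odot> e3)"
    have xee: "(x \<odot> e2) \<odot> e3 \<in> Hom C (Dom C e3) X" using xe e3A e3(2) e(3) e2A by simp
    have rw: "\<forall>i. 1 \<le> i \<and> i \<le> k \<longrightarrow> r i \<odot> ((x \<odot> e2) \<odot> e3) = r i \<odot> w"
      by (rule iffD1[OF ker[THEN spec, THEN spec, THEN spec, THEN mp, OF conjI[OF xee e3(3)]] fw])
    have 1: "r i \<odot> w = b i \<odot> ?e" if i: "1 \<le> i" "i \<le> k" for i
    proof -
      have "r i \<odot> w = r i \<odot> ((x \<odot> e2) \<odot> e3)" using rw i by metis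
      also have "\<dots> = b i \<odot> ((e \<odot> e2) \<odot> e3)"
        by (rule Comp_cong_right[OF rx[OF i]]) (use R(2,3)[of i] B[of i] i e(2,3) eA e2A e3A e3(2) in auto)
      finally show ?thesis using eA e2A e3A e3(2) by simp
    qed
    have "?s \<odot> (y \<odot> e3) = (?c \<odot> e) \<odot> (e2 \<odot> e3)"
      by (rule Comp_cong_right[OF ey]) (use c e(2) eA s y e2A e3A e3(2) in auto)
    then have 2: "?s \<odot> w = ?c \<odot> ?e" using sw c e(2) eA e2A e3A e3(2) by simp
    have "regular_epi C (e2 \<odot> e3)" using regular_epi_comp[OF e3(1) e2(1)] e3(2) by simp
    then have "regular_epi C ?e" using regular_epi_comp[of "e2 \<odot> e3" e] e(1) e2A e3A e3(2) by simp
    moreover have "Cod C ?e = T" "Dom C ?e = Dom C e3" using e(2) eA e2A e3A e3(2) by auto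
    moreover have "\<forall>i. 1 \<le> i \<and> i \<le> Suc k \<longrightarrow> r i \<odot> w = b i \<odot> ?e"
      using 1 2 by (metis le_Suc_eq)
    ultimately show ?case using e3(3) by metis
  qed
  then show ?thesis using that by blast
qed

text \<open>The limit projections are the universal compatible family. A solution \<open>x\<close>
  for them over a cover \<open>e\<close> of \<open>L\<close> satisfies
  \<open>h \<odot> x = e\<close>, so the comparison morphism \<open>h\<close> is a left factor of a
  regular epimorphism.\<close>

lemma pairwise_condition_if_kernels_distribute:
  assumes kd: "\<And>X. X \<in> Obj C \<Longrightarrow> kernels_distribute C X" and n: "1 \<le> n"
  shows "pairwise_condition C n"
  unfolding pairwise_condition_def
proof (intro allI impI conjI)
  fix X B r
  assume r: "\<forall>i. 1 \<le> i \<and> i \<le> n \<longrightarrow> r i \<in> Hom C X (B i) \<and> regular_epi C (r i)"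
  then have R: "regular_epi C (r i) \<and> Dom C (r i) = X" "Cod C (r i) = B i" "r i \<in> Arr C" if "1 \<le> i" "i \<le> n" for i
    using that by auto
  show "\<exists>p q. is_pushout C (r i) (r j) p q" if "1 \<le> i \<and> i < j \<and> j \<le> n" for i j
    using pushout_of_regular_epis[of "r i" X "r j"] R(1)[of i] R(1)[of j] that by (metis le_trans less_imp_le_nat)
  fix D p q L l
  assume H: "(\<forall>i j. 1 \<le> i \<and> i < j \<and> j \<le> n \<longrightarrow>
             p i j \<in> Hom C (B i) (D i j) \<and> q i j \<in> Hom C (B j) (D i j) \<and>
             is_pushout C (r i) (r j) (p i j) (q i j)) \<and>
          is_limit C (pairwise_diagram n B D p q) L l"
  let ?G = "pairwise_diagram n B D p q"
  have pq: "\<forall>i j. 1 \<le> i \<and> i < j \<and> j \<le> n \<longrightarrow> p i j \<in> Hom C (B i) (D i j) \<and> q i j \<in> Hom C (B j) (D i j)"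
    and po: "\<And>i j. 1 \<le> i \<Longrightarrow> i < j \<Longrightarrow> j \<le> n \<Longrightarrow> is_pushout C (r i) (r j) (p i j) (q i j)"
    and L: "is_limit C ?G L l"
    using H by blast+
  note cone_iff = is_cone_pairwise_iff[of n p B D q, OF pq]
  have X: "X \<in> Obj C" using R(1)[of 1] R(3)[of 1] n by (metis Dom_Obj order_refl)
  have lc: "is_cone C ?G L l" using L by (simp add: is_limit_def)
  have lB: "l (Base i) \<in> Hom C L (Cod C (r i))" if "1 \<le> i" "i \<le> n" for i
    using lc that R(2)[OF that] unfolding cone_iff by simp
  have leq: "p i j \<odot> l (Base i) = q i j \<odot> l (Base j)" if "1 \<le> i" "i < j" "j \<le> n" for i j
    using lc that unfolding cone_iff by blast
  have c: "is_cone C ?G X (pairwise_cone C r p)"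
    unfolding cone_iff pairwise_cone_def using X r pushoutD(9)[OF po] by (simp del: Hom_iff)
  define h where "h = comparison C ?G L l X (pairwise_cone C r p)"
  have h: "h \<in> Hom C X L \<and> (\<forall>i. 1 \<le> i \<and> i \<le> n \<longrightarrow> l (Base i) \<odot> h = r i)"
    using comparison_mediates[OF L c]
    unfolding h_def[symmetric] mediates_pairwise_iff[of n p B D q, OF pq lc c] by (simp add: pairwise_cone_def)
  obtain e x where e: "regular_epi C e" "Cod C e = L" "x \<in> Hom C (Dom C e) X"
    and ex: "\<And>i. 1 \<le> i \<Longrightarrow> i \<le> n \<Longrightarrow> r i \<odot> x = l (Base i) \<odot> e"
    by (rule remainder_theorem[OF kd[OF X] n, of r p q "\<lambda>i. l (Base i)" L]) (use R(1) po lB leq in blast)+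
  have eA: "e \<in> Arr C" using e by simp
  have le: "l (Base i) \<odot> e \<in> Hom C (Dom C e) (B i)" if "1 \<le> i" "i \<le> n" for i
    using lB[OF that] R(2)[OF that] eA e(2) by simp
  have lh: "l (Base i) \<odot> (h \<odot> x) = l (Base i) \<odot> e" if i: "1 \<le> i" "i \<le> n" for i
  proof -
    have "l (Base i) \<odot> h = r i" using h i by blast
    then have "l (Base i) \<odot> (h \<odot> x) = r i \<odot> x"
      by (rule Comp_rewrite) (use lB[OF i] h e(3) in auto)
    then show ?thesis using ex[OF i] by simp
  qed
  \<comment> \<open>The limit cone restricted along \<open>e\<close>; both \<open>e\<close> and
    \<open>h \<odot> x\<close> mediate it, which forces them to be equal.\<close>
  define d where "d = (\<lambda>v. case v of Base i \<Rightarrow> l (Base i) \<odot> e | Apex i j \<Rightarrow> p i j \<odot> (l (Base i) \<odot> e))"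
  have "p i j \<odot> (l (Base i) \<odot> e) = q i j \<odot> (l (Base j) \<odot> e)" if ij: "1 \<le> i" "i < j" "j \<le> n" for i j
  proof -
    have "i \<le> n" "1 \<le> j" using ij by auto
    then show ?thesis
      by (intro Comp_cong_right[OF leq[OF ij]]) (use pushoutD[OF po[OF ij]] lB[of i] lB[of j] ij eA e(2) in auto)
  qed
  then have dc: "is_cone C ?G (Dom C e) d"
    unfolding cone_iff d_def using le eA by (simp del: Hom_iff)
  have "d (Base i) = l (Base i) \<odot> e" for i by (simp add: d_def)
  then have "mediates C ?G L l (Dom C e) d e" "mediates C ?G L l (Dom C e) d (h \<odot> x)"
    unfolding mediates_pairwise_iff[of n p B D q, OF pq lc dc] using eA e(2,3) h lh by auto
  then have "h \<odot> x = e" using limit_unique[OF L dc] by blast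
  then have "regular_epi C (h \<odot> x)" using e(1) by simp
  then show "regular_epi C (comparison C ?G L l X (pairwise_cone C r p))"
    unfolding h_def[symmetric] by (rule regular_epi_left_factor) (use h e(3) in auto)
qed

end

lemma (in exact_arithmetical_category) pairwise_condition:
  assumes "1 \<le> n"
  shows "pairwise_condition C n"
proof -
  interpret E: exact_maltsev_category C by unfold_locales
  show ?thesis
  proof (rule E.pairwise_condition_if_kernels_distribute[OF _ assms])
    fix X assume X: "X \<in> Obj C"
    then obtain P p q where pr: "is_product C X X P p q" using product_exists by blast
    show "kernels_distribute C X"
      by (rule E.kernels_distribute_if_distributive[OF pr Equiv_distributive[OF pr]])
  qed
qed

theorem corollary5p5:
  fixes C :: "('o, 'm) category_data" and n :: nat
  assumes "regular_category C" and "n \<ge> 3"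
  shows "exact_arithmetical_category C \<longleftrightarrow>
    (\<forall>X B r. (\<forall>i. 1 \<le> i \<and> i \<le> n \<longrightarrow> r i \<in> Hom C X (B i) \<and> regular_epi C (r i)) \<longrightarrow>
       (\<forall>i j. 1 \<le> i \<and> i < j \<and> j \<le> n \<longrightarrow> (\<exists>p q. is_pushout C (r i) (r j) p q)) \<and>
       (\<forall>D p q L l.
          (\<forall>i j. 1 \<le> i \<and> i < j \<and> j \<le> n \<longrightarrow>
             p i j \<in> Hom C (B i) (D i j) \<and> q i j \<in> Hom C (B j) (D i j) \<and>
             is_pushout C (r i) (r j) (p i j) (q i j)) \<and>
          is_limit C (pairwise_diagram n B D p q) L l \<longrightarrow>
          regular_epi C
            (comparison C (pairwise_diagram n B D p q) L l X (pairwise_cone C r p))))"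
  unfolding pairwise_condition_def[symmetric]
  using exact_arithmetical_category.pairwise_condition[of C n]
    regular_category.exact_arithmetical_if_pairwise_condition[OF assms(1) _ assms(2)] assms(2)
  by auto

end
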